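(* If $f(x,y)\in\bar{\mathcal{R}}_G$, then: 1. The set of discontinuity points of $f$ is at most countable. 2. $f\in L(\bar G)$. 3. For every $(x_0,y_0)\in G$ and every $d\in D_f(x_0,y_0)$ there exists a character $\chi\in X^G_{(x_0,y_0)}$ such that $\chi(f)=d$.
   Context: $G$ is a (nonempty) connected open subset of $\mathbb{R}^2$ with compact closure $\bar G$ and boundary $\partial G$. $B(\bar G)$ is the Banach algebra of all bounded real functions on $\bar G$ with the sup-norm. A rational function is $f=p/q$ with $p,q$ mutually prime real polynomials in $x,y$, $q\neq0$. Convention: whenever the iterated limit $\lim_{x\to x_0}\lim_{y\to y_0}f(x,y)$ is finite, one sets $f(x_0,y_0)$ equal to it. $\bar{\mathcal{R}}_G$ is the closure in $B(\bar G)$ of the subalgebra of all rational functions that are bounded on $G$ and continuous on $\partial G$; it contains $C(\bar G)$. $X^G$ is the set of all nontrivial homomorphisms (characters) $\bar{\mathcal{R}}_G\to\mathbb{R}$, and $X^G_{(x,y)}=\{\chi\in X^G:\chi(g)=g(x,y)\ \forall g\in C(\bar G)\}$. $D_f(x_0,y_0)=\bigcap_V\overline{f(V)}$, $V$ ranging over all neighbourhoods of $(x_0,y_0)$ (in $\bar G$). A function of type $\mathcal{I}$ is $\Phi_N(t)=\sum_{k=1}^N\phi_k|t|^{e_k}$ with $N\in\mathbb{Z}^+=\{0,1,2,\dots\}$, $\phi_k\in\mathbb{R}\setminus\{0\}$, $e_k\in\mathbb{Q}$, $1\le e_1<\dots<e_N$ ($\Phi_0=0$). A series of type $\mathcal{II}$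 is a formal series $\sum_{k=1}^\infty\phi_k|t|^{e_k}$ all of whose partial sums are of type $\mathcal{I}$. $L(\bar G)$ is the set of all $f\in B(\bar G)$ such that: (i) $f$ is continuous on the boundary of $G$; (ii) for every $(x_0,y_0)\in G$ and every curve $L$ of the following kinds, the limit of $f(x,y)$ as $(x,y)\to(x_0,y_0)$ along $L$ exists: the curves $y=y_0+h(x-x_0)$ near $x_0$, restricted to $x\ge x_0$ or to $x\le x_0$, and the curves $x=x_0+h(y-y_0)$ near $y_0$, restricted to $y\ge y_0$ or to $y\le y_0$, where $h(0)=0$ and, for $t\ne0$, $h(t)$ is one of $\Phi_N(t)$; $\Phi_N(t)+|t|^e$ with $e\notin\mathbb{Q}$; $\Phi_N(t)+\frac{|t|^e}{\ln|t|}$ with $e\in\mathbb{Q}$; $\Phi_N(t)+|t|^e\ln|t|$ with $e\in\mathbb{Q}$; here $\Phi_N$ is of type $\mathcal{I}$, $e\geq 1$ if $N=0$ and $e\ge e_N$ if $N\ge1$; (iii) for every $(x_0,y_0)\in G$ and every series of type $\mathcal{II}$ with partial sums $\Phi_N$, the limit $\lim_{N\to\infty}\lim_{(x,y)\in L_N,\,(x,y)\to(x_0,y_0)}f(x,y)$ exists, where $L_N$ is the curve $y=y_0+\Phi_N(x-x_0)$ restricted (for all $N$) to $x\ge x_0$ or (for all $N$) to $x\le x_0$, or the curve $x=x_0+\Phi_N(y-y_0)$ restricted (for all $N$) to $y\ge y_0$ or (for all $N$) to $y\le y_0$. *)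

theory Defs
  imports
    "HOL-Analysis.Analysis"
    "HOL-Computational_Algebra.Computational_Algebra"
begin

text \<open>
  Functions on the closure of \<open>G\<close> are represented by functions on the plane that are
  \<^const>\<open>extensional\<close> on \<open>closure G\<close>, so that equality of such functions is equality on
  \<open>closure G\<close>. The distance of \<^const>\<open>funspace\<close> is the supremum distance.
\<close>

definition bfun_metric :: "(real \<times> real) set \<Rightarrow> (real \<times> real \<Rightarrow> real) metric" where
  "bfun_metric G = funspace (closure G) euclidean_metric"

abbreviation bfun :: "(real \<times> real) set \<Rightarrow> (real \<times> real \<Rightarrow> real) set" where
  "bfun G \<equiv> mspace (bfun_metric G)"

definition cfun :: "(real \<times> real) set \<Rightarrow> (real \<times> real \<Rightarrow> real) set" where
  "cfun G = {g \<in> extensional (closure G). continuous_on (closure G) g}"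


text \<open>
  A polynomial in \<open>x, y\<close> is an element of \<open>\<real>[x][y]\<close>: the coefficients of the outer
  polynomial are polynomials in \<open>x\<close>, and the outer indeterminate is \<open>y\<close>.
\<close>

definition poly_xy :: "real poly poly \<Rightarrow> real \<Rightarrow> real \<Rightarrow> real" where
  "poly_xy p x y = poly (poly p [:y:]) x"

definition has_iterated_limit ::
    "(real \<Rightarrow> real \<Rightarrow> real) \<Rightarrow> real \<Rightarrow> real \<Rightarrow> real \<Rightarrow> bool" where
  "has_iterated_limit F x0 y0 l \<longleftrightarrow>
     (\<exists>g. (\<forall>\<^sub>F x in at x0. (F x \<longlongrightarrow> g x) (at y0)) \<and> (g \<longlongrightarrow> l) (at x0))"

text \<open>
  The value of \<open>p/q\<close> at a point, with the convention that at a zero of \<open>q\<close> it is the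
  iterated limit, provided this is finite; otherwise \<open>p/q\<close> has no value at that point.
  If \<open>p, q\<close> are coprime and \<open>q \<noteq> 0\<close>, then for all but finitely many \<open>x\<close> the denominator
  does not vanish at \<open>(x, y)\<close> for \<open>y\<close> close to, but different from, \<open>y0\<close>. Hence the
  value \<open>a / 0 = 0\<close> has no influence on the iterated limit.
\<close>

definition rat_value :: "real poly poly \<Rightarrow> real poly poly \<Rightarrow> real \<times> real \<Rightarrow> real \<Rightarrow> bool" where
  "rat_value p q z v \<longleftrightarrow>
     (if poly_xy q (fst z) (snd z) \<noteq> 0
      then v = poly_xy p (fst z) (snd z) / poly_xy q (fst z) (snd z)
      else has_iterated_limit (\<lambda>x y. poly_xy p x y / poly_xy q x y) (fst z) (snd z) v)"

definition rat_fun :: "(real \<times> real) set \<Rightarrow> (real \<times> real \<Rightarrow> real) set" where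
  "rat_fun G = {f \<in> extensional (closure G).
     (\<exists>p q. coprime p q \<and> q \<noteq> 0 \<and> (\<forall>z\<in>closure G. rat_value p q z (f z))) \<and>
     bounded (f ` G) \<and>
     (\<forall>z\<in>frontier G. continuous (at z within closure G) f)}"

definition rat_closure :: "(real \<times> real) set \<Rightarrow> (real \<times> real \<Rightarrow> real) set" where
  "rat_closure G = mtopology_of (bfun_metric G) closure_of rat_fun G"

definition characters :: "(real \<times> real) set \<Rightarrow> ((real \<times> real \<Rightarrow> real) \<Rightarrow> real) set" where
  "characters G = {\<psi> \<in> extensional (rat_closure G).
     (\<forall>f\<in>rat_closure G. \<forall>g\<in>rat_closure G. \<psi> (\<lambda>z\<in>closure G. f z + g z) = \<psi> f + \<psi> g) \<and>
     (\<forall>f\<in>rat_closure G. \<forall>g\<in>rat_closure G. \<psi> (\<lambda>z\<in>closure G. f z * g z) = \<psi> f * \<psi> g) \<and>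
     (\<forall>c. \<forall>f\<in>rat_closure G. \<psi> (\<lambda>z\<in>closure G. c * f z) = c * \<psi> f) \<and>
     (\<exists>f\<in>rat_closure G. \<psi> f \<noteq> 0)}"

definition characters_at ::
    "(real \<times> real) set \<Rightarrow> real \<times> real \<Rightarrow> ((real \<times> real \<Rightarrow> real) \<Rightarrow> real) set" where
  "characters_at G z = {\<psi> \<in> characters G. \<forall>g\<in>cfun G. \<psi> g = g z}"

definition cluster_values ::
    "(real \<times> real) set \<Rightarrow> (real \<times> real \<Rightarrow> real) \<Rightarrow> real \<times> real \<Rightarrow> real set" where
  "cluster_values G f z =
     (\<Inter>V \<in> {V. V \<subseteq> closure G \<and> (\<exists>U. open U \<and> z \<in> U \<and> U \<inter> closure G \<subseteq> V)}. closure (f ` V))"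


definition type_I :: "nat \<Rightarrow> (nat \<Rightarrow> real) \<Rightarrow> (nat \<Rightarrow> real) \<Rightarrow> bool" where
  "type_I N \<phi> e \<longleftrightarrow>
     (\<forall>k\<in>{1..N}. \<phi> k \<noteq> 0 \<and> e k \<in> \<rat> \<and> 1 \<le> e k) \<and> strict_mono_on {1..N} e"

definition Phi :: "nat \<Rightarrow> (nat \<Rightarrow> real) \<Rightarrow> (nat \<Rightarrow> real) \<Rightarrow> real \<Rightarrow> real" where
  "Phi N \<phi> e t = (\<Sum>k=1..N. \<phi> k * \<bar>t\<bar> powr e k)"

definition type_II :: "(nat \<Rightarrow> real) \<Rightarrow> (nat \<Rightarrow> real) \<Rightarrow> bool" where
  "type_II \<phi> e \<longleftrightarrow> (\<forall>N. type_I N \<phi> e)"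

definition exponent_ok :: "nat \<Rightarrow> (nat \<Rightarrow> real) \<Rightarrow> real \<Rightarrow> bool" where
  "exponent_ok N e a \<longleftrightarrow> (if N = 0 then 1 \<le> a else e N \<le> a)"

text \<open>
  Only the germ of \<open>h\<close> at \<open>0\<close> matters below, so the zero of \<open>ln \<bar>t\<bar>\<close> at \<open>\<bar>t\<bar> = 1\<close> is
  harmless. Since \<open>0 powr a = 0\<close>, all these functions vanish at \<open>0\<close>.
\<close>

inductive test_fun :: "(real \<Rightarrow> real) \<Rightarrow> bool" where
  plain: "type_I N \<phi> e \<Longrightarrow> test_fun (Phi N \<phi> e)"
| irrational: "\<lbrakk>type_I N \<phi> e; exponent_ok N e a; a \<notin> \<rat>\<rbrakk> \<Longrightarrow>
    test_fun (\<lambda>t. Phi N \<phi> e t + \<bar>t\<bar> powr a)"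
| div_ln: "\<lbrakk>type_I N \<phi> e; exponent_ok N e a; a \<in> \<rat>\<rbrakk> \<Longrightarrow>
    test_fun (\<lambda>t. Phi N \<phi> e t + \<bar>t\<bar> powr a / ln \<bar>t\<bar>)"
| times_ln: "\<lbrakk>type_I N \<phi> e; exponent_ok N e a; a \<in> \<rat>\<rbrakk> \<Longrightarrow>
    test_fun (\<lambda>t. Phi N \<phi> e t + \<bar>t\<bar> powr a * ln \<bar>t\<bar>)"

lemma test_fun_0: "test_fun h \<Longrightarrow> h 0 = 0"
  by (induction rule: test_fun.induct) (simp_all add: Phi_def)

datatype side = X_right | X_left | Y_up | Y_down

fun half_curve :: "side \<Rightarrow> (real \<Rightarrow> real) \<Rightarrow> real \<times> real \<Rightarrow> (real \<times> real) set" where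
  "half_curve X_right h (x0, y0) = {(x, y0 + h (x - x0)) | x. x \<ge> x0}"
| "half_curve X_left h (x0, y0) = {(x, y0 + h (x - x0)) | x. x \<le> x0}"
| "half_curve Y_up h (x0, y0) = {(x0 + h (y - y0), y) | y. y \<ge> y0}"
| "half_curve Y_down h (x0, y0) = {(x0 + h (y - y0), y) | y. y \<le> y0}"

definition L_space :: "(real \<times> real) set \<Rightarrow> (real \<times> real \<Rightarrow> real) set" where
  "L_space G = {f \<in> bfun G.
     (\<forall>z\<in>frontier G. continuous (at z within closure G) f) \<and>
     (\<forall>z\<in>G. \<forall>s h. test_fun h \<longrightarrow> (\<exists>l. (f \<longlongrightarrow> l) (at z within half_curve s h z))) \<and>
     (\<forall>z\<in>G. \<forall>s \<phi> e. type_II \<phi> e \<longrightarrow>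
        (\<exists>l. (\<forall>N. (f \<longlongrightarrow> l N) (at z within half_curve s (Phi N \<phi> e) z)) \<and> convergent l))}"

end

theory Submission
  imports Defs "HOL-Real_Asymp.Real_Asymp" "HOL-Computational_Algebra.Field_as_Ring"
begin

text \<open>
  The assertions on discontinuities and on limits along curves are proved for the rational functions
  $f = p/q$ that are bounded on \<open>G\<close> and continuous on its boundary, and then pass to uniform limits.
  The assertion on characters is proved for all functions in the closure at once.

  For rational $f$, boundedness forces every zero of $q$ in \<open>G\<close> to be a zero of $p$, and coprime
  polynomials have only finitely many common zeros
  (\<open>finite_common_zeros\<close>, by elimination, \<open>coprime_elimination\<close>). Hence $f$ has finitely many
  discontinuities and, near any point of \<open>G\<close> except possibly at the point itself, is a quotient
  of polynomials whose denominator does not vanish.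

  Along one test curve, numerator and denominator become finite sums of monomials
  $t^a (\ln t)^k$. Such a sum is zero or asymptotic to its largest monomial, and a bounded quotient
  of two of them converges (\<open>bounded_log_sum_quotient_convergent\<close>).

  Along the partial sums $\Phi_N$ of a series, the limits of $p/q$ are eventually constant in $N$
  (\<open>convergent_limits_along_series\<close>). If the exponents $e_k$ tend to infinity, elimination bounds
  the order of vanishing of $q$ along all $\Phi_N$ at once, so the late terms of the series do not
  matter. If they stay bounded, the leading terms of $p$ and $q$ along $\Phi_N$ stabilise
  (\<open>stable_along_or_exponents_unbounded\<close>), because a polynomial can only fail to stabilise along
  a series whose exponents have bounded denominators, and such exponents tend to infinity.

  For the characters, evaluation at points of the closure is multiplicative, and Tychonoff's
  theorem provides pointwise cluster points of evaluations along points that tend to the given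
  point while $f$ tends to the given cluster value (\<open>exists_character_with_cluster_value\<close>). This uses that the
  closure of the rational functions is an algebra, which rests on describing all values as
  iterated limits, and that it contains the continuous functions, by Stone-Weierstrass.
\<close>

section \<open>Finite sums of logarithmic monomials\<close>

definition log_monom :: "real \<times> int \<Rightarrow> real \<Rightarrow> real" where
  "log_monom s t = t powr fst s * ln t powi snd s"

text \<open>
  Only the germ at $0^+$ matters in the limits below, and on the unit interval \<open>ln t\<close> has
  no zero, so negative powers of the logarithm are harmless there. The exponent set \<open>A\<close> is a
  parameter because the argument about series keeps track of the denominators of exponents.
\<close>

definition log_sums :: "(real \<times> int) set \<Rightarrow> (real \<Rightarrow> real) set" where
  "log_sums A = {g. \<exists>S c. finite S \<and> S \<subseteq> A \<and>
     (\<forall>t\<in>{0<..<1}. g t = (\<Sum>s\<in>S. c s * log_monom s t))}"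

lemma eventually_unit_interval: "\<forall>\<^sub>F t::real in at_right 0. t \<in> {0<..<1}"
  using eventually_at_right_real[of 0 1] by simp

lemma log_monom_nonzero: "t \<in> {0<..<1} \<Longrightarrow> log_monom s t \<noteq> 0"
  by (simp add: log_monom_def)

lemma log_monom_add:
  "t \<in> {0<..<1} \<Longrightarrow> log_monom (r + s) t = log_monom r t * log_monom s t"
  by (simp add: log_monom_def powr_add power_int_add)

lemma log_monom_diff:
  "t \<in> {0<..<1} \<Longrightarrow> log_monom (r - s) t = log_monom r t / log_monom s t"
  by (simp add: log_monom_def powr_diff power_int_diff)

lemma log_sums_cong:
  "g \<in> log_sums A \<Longrightarrow> (\<And>t. t \<in> {0<..<1} \<Longrightarrow> h t = g t) \<Longrightarrow> h \<in> log_sums A"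
  by (simp add: log_sums_def)

lemma log_sums_monom:
  assumes "s \<in> A" shows "(\<lambda>t. c * log_monom s t) \<in> log_sums A"
  unfolding log_sums_def using assms
  by (intro CollectI exI[of _ "{s}"] exI[of _ "\<lambda>_. c"]) auto

lemma log_sums_add:
  assumes "g \<in> log_sums A" "h \<in> log_sums A"
  shows "(\<lambda>t. g t + h t) \<in> log_sums A"
proof -
  obtain S c where S: "finite S" "S \<subseteq> A" "\<forall>t\<in>{0<..<1}. g t = (\<Sum>s\<in>S. c s * log_monom s t)"
    using assms(1) unfolding log_sums_def by auto
  obtain T d where T: "finite T" "T \<subseteq> A" "\<forall>t\<in>{0<..<1}. h t = (\<Sum>s\<in>T. d s * log_monom s t)"
    using assms(2) unfolding log_sums_def by auto
  define c' where "c' s = (if s \<in> S then c s else 0)" for s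
  define d' where "d' s = (if s \<in> T then d s else 0)" for s
  have "g t + h t = (\<Sum>s\<in>S \<union> T. (c' s + d' s) * log_monom s t)" if "t \<in> {0<..<1}" for t
  proof -
    have "(\<Sum>s\<in>S. c s * log_monom s t) = (\<Sum>s\<in>S \<union> T. c' s * log_monom s t)"
      unfolding c'_def by (intro sum.mono_neutral_cong_left) (use S T in auto)
    moreover have "(\<Sum>s\<in>T. d s * log_monom s t) = (\<Sum>s\<in>S \<union> T. d' s * log_monom s t)"
      unfolding d'_def by (intro sum.mono_neutral_cong_left) (use S T in auto)
    ultimately show ?thesis
      using S(3) T(3) that by (simp add: sum.distrib distrib_right)
  qed
  then show ?thesis
    unfolding log_sums_def using S(1,2) T(1,2)
    by (intro CollectI exI[of _ "S \<union> T"] exI[of _ "\<lambda>s. c' s + d' s"]) auto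
qed

lemma log_sums_zero: "(\<lambda>t. 0) \<in> log_sums A"
  unfolding log_sums_def by (intro CollectI exI[of _ "{}"]) auto

lemma log_sums_sum:
  assumes "\<And>i. i \<in> I \<Longrightarrow> g i \<in> log_sums A"
  shows "(\<lambda>t. \<Sum>i\<in>I. g i t) \<in> log_sums A"
  using assms
  by (induction I rule: infinite_finite_induct) (simp_all add: log_sums_zero log_sums_add)

lemma log_sums_mult:
  assumes A: "\<And>r s. r \<in> A \<Longrightarrow> s \<in> A \<Longrightarrow> r + s \<in> A"
    and "g \<in> log_sums A" "h \<in> log_sums A"
  shows "(\<lambda>t. g t * h t) \<in> log_sums A"
proof -
  obtain S c where S: "S \<subseteq> A" "\<forall>t\<in>{0<..<1}. g t = (\<Sum>s\<in>S. c s * log_monom s t)"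
    using assms(2) unfolding log_sums_def by auto
  obtain T d where T: "T \<subseteq> A" "\<forall>t\<in>{0<..<1}. h t = (\<Sum>s\<in>T. d s * log_monom s t)"
    using assms(3) unfolding log_sums_def by auto
  have "(\<lambda>t. \<Sum>s\<in>S. \<Sum>r\<in>T. (c s * d r) * log_monom (s + r) t) \<in> log_sums A"
    by (intro log_sums_sum log_sums_monom A) (use S T in auto)
  moreover have "g t * h t = (\<Sum>s\<in>S. \<Sum>r\<in>T. (c s * d r) * log_monom (s + r) t)"
    if "t \<in> {0<..<1}" for t
  proof -
    have "g t * h t = (\<Sum>s\<in>S. \<Sum>r\<in>T. (c s * log_monom s t) * (d r * log_monom r t))"
      using that S(2) T(2) by (simp only: sum_product)
    also have "\<dots> = (\<Sum>s\<in>S. \<Sum>r\<in>T. (c s * d r) * log_monom (s + r) t)"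
      by (intro sum.cong refl) (simp only: log_monom_add[OF that] mult_ac)
    finally show ?thesis .
  qed
  ultimately show ?thesis by (rule log_sums_cong)
qed

text \<open>
  The logarithm only decides between equal powers of \<open>t\<close>; so the monomials are totally
  ordered by size near \<open>0\<close>, lexicographically in the two exponents.
\<close>

lemma log_monom_tendsto_0:
  assumes "fst s > 0 \<or> fst s = 0 \<and> snd s < 0"
  shows "(log_monom s \<longlongrightarrow> 0) (at_right 0)"
proof (cases "snd s \<ge> 0")
  case True
  then obtain n where n: "snd s = int n" using nonneg_int_cases by blast
  have a: "fst s > 0" using assms True by auto
  have "((\<lambda>t. t powr fst s * ln t ^ n) \<longlongrightarrow> 0) (at_right 0)"
    using a by real_asymp
  then show ?thesis by (simp add: log_monom_def[abs_def] n)
next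
  case False
  then obtain n where n: "snd s = - int (Suc n)"
    by (metis add.inverse_inverse int_cases2 linorder_not_le negD)
  have "((\<lambda>t::real. inverse (ln t) ^ Suc n) \<longlongrightarrow> 0 ^ Suc n) (at_right 0)"
    by (intro tendsto_power) real_asymp
  then have 1: "((\<lambda>t::real. inverse (ln t) ^ Suc n) \<longlongrightarrow> 0) (at_right 0)" by simp
  have 2: "((\<lambda>t::real. t powr fst s) \<longlongrightarrow> (if fst s = 0 then 1 else 0)) (at_right 0)"
  proof (cases "fst s = 0")
    case True
    then show ?thesis
      by (auto intro!: tendsto_eventually eventually_mono[OF eventually_unit_interval])
  next
    case False
    then have "fst s > 0" using assms by auto
    then have "((\<lambda>t::real. t powr fst s) \<longlongrightarrow> 0) (at_right 0)" by real_asymp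
    with False show ?thesis by simp
  qed
  have "log_monom s t = t powr fst s * inverse (ln t) ^ Suc n" for t
    by (simp only: log_monom_def n power_int_minus power_int_of_nat power_inverse)
  then have "log_monom s = (\<lambda>t. t powr fst s * inverse (ln t) ^ Suc n)" by blast
  with tendsto_mult[OF 2 1] show ?thesis by simp
qed

text \<open>
  Among finitely many monomials with nonzero coefficients there is a single largest one near
  \<open>0\<close>, and the quotient of every other one by it tends to \<open>0\<close>; no cancellation is possible.
\<close>

lemma log_sums_leading_term:
  assumes "g \<in> log_sums A"
  shows "(\<forall>t\<in>{0<..<1}. g t = 0) \<or>
    (\<exists>s\<in>A. \<exists>c. c \<noteq> 0 \<and> ((\<lambda>t. g t / log_monom s t) \<longlongrightarrow> c) (at_right 0))"
proof -
  obtain S0 c where S0: "finite S0" "S0 \<subseteq> A"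
      "\<forall>t\<in>{0<..<1}. g t = (\<Sum>s\<in>S0. c s * log_monom s t)"
    using assms unfolding log_sums_def by auto
  define S where "S = {s\<in>S0. c s \<noteq> 0}"
  have S: "finite S" "S \<subseteq> A" "\<And>s. s \<in> S \<Longrightarrow> c s \<noteq> 0" using S0 by (auto simp: S_def)
  have g: "g t = (\<Sum>s\<in>S. c s * log_monom s t)" if "t \<in> {0<..<1}" for t
    using S0(3) that S0(1) by (auto simp: S_def intro!: sum.mono_neutral_right)
  show ?thesis
  proof (cases "S = {}")
    case True
    then show ?thesis using g by simp
  next
    case False
    \<comment> \<open>The dominant monomial has the least power of \<open>t\<close> and, among these, the largest power of
      the logarithm.\<close>
    define a where "a = Min (fst ` S)"
    define S1 where "S1 = {s\<in>S. fst s = a}"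
    have "a \<in> fst ` S" unfolding a_def using S False by (intro Min_in) auto
    then have S1: "finite S1" "S1 \<noteq> {}" using S by (auto simp: S1_def)
    define k where "k = Max (snd ` S1)"
    have "k \<in> snd ` S1" unfolding k_def using S1 by (intro Max_in) auto
    then have aS: "(a, k) \<in> S" by (force simp: S1_def)
    have lead: "fst (s - (a, k)) > 0 \<or> fst (s - (a, k)) = 0 \<and> snd (s - (a, k)) < 0"
      if "s \<in> S" "s \<noteq> (a, k)" for s
    proof -
      have "a \<le> fst s" unfolding a_def using S that by simp
      moreover have "snd s \<le> k" if "fst s = a"
        unfolding k_def using S1 \<open>s \<in> S\<close> that by (intro Max_ge) (auto simp: S1_def)
      ultimately show ?thesis using that by (cases s) force
    qed
    have "((\<lambda>t. \<Sum>s\<in>S. c s * log_monom (s - (a, k)) t) \<longlongrightarrow> (\<Sum>s\<in>S. if s = (a, k) then c s else 0))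
        (at_right 0)"
    proof (intro tendsto_sum)
      fix s assume s: "s \<in> S"
      show "((\<lambda>t. c s * log_monom (s - (a, k)) t) \<longlongrightarrow> (if s = (a, k) then c s else 0)) (at_right 0)"
      proof (cases "s = (a, k)")
        case True
        have "\<forall>\<^sub>F t in at_right 0. c s * log_monom (s - (a, k)) t = c s"
          using eventually_unit_interval
          by eventually_elim (simp add: True log_monom_def)
        from tendsto_eventually[OF this] True show ?thesis by simp
      next
        case False
        then show ?thesis
          using tendsto_mult_right_zero[OF log_monom_tendsto_0[OF lead[OF s False]]] by simp
      qed
    qed
    moreover have "\<forall>\<^sub>F t in at_right 0.
        (\<Sum>s\<in>S. c s * log_monom (s - (a, k)) t) = g t / log_monom (a, k) t"
      using eventually_unit_interval
      by eventually_elim (simp only: g log_monom_diff sum_divide_distrib times_divide_eq_right)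
    ultimately have "((\<lambda>t. g t / log_monom (a, k) t) \<longlongrightarrow> c (a, k)) (at_right 0)"
      using aS S(1) by (simp add: tendsto_cong)
    then show ?thesis using aS S by blast
  qed
qed

text \<open>
  A monomial tends to \<open>0\<close>, is constantly \<open>1\<close> or tends to infinity in absolute value. The
  last possibility is what boundedness excludes.
\<close>

lemma bounded_log_monom_like_convergent:
  assumes lim: "((\<lambda>t. g t / log_monom s t) \<longlongrightarrow> c) (at_right 0)" and c: "c \<noteq> 0"
    and bdd: "\<forall>\<^sub>F t in at_right 0. \<bar>g t\<bar> \<le> C"
  shows "\<exists>l. (g \<longlongrightarrow> l) (at_right 0)"
proof -
  have eq: "\<forall>\<^sub>F t in at_right 0. (g t / log_monom s t) * log_monom s t = g t"
    using eventually_unit_interval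
    by eventually_elim (use log_monom_nonzero in auto)
  have conv: "\<exists>l. (g \<longlongrightarrow> l) (at_right 0)" if "(log_monom s \<longlongrightarrow> l) (at_right 0)" for l
    using tendsto_mult[OF lim that] eq by (auto simp: tendsto_cong)
  consider "s = 0" | "fst s > 0 \<or> fst s = 0 \<and> snd s < 0"
    | "fst (0 - s) > 0 \<or> fst (0 - s) = 0 \<and> snd (0 - s) < 0"
    by (cases s) (force simp: zero_prod_def)
  then show ?thesis
  proof cases
    case 1
    have "(log_monom s \<longlongrightarrow> 1) (at_right 0)"
      by (intro tendsto_eventually eventually_mono[OF eventually_unit_interval])
        (simp add: 1 log_monom_def)
    then show ?thesis by (rule conv)
  next
    case 2
    then show ?thesis using conv log_monom_tendsto_0 by blast
  next
    case 3
    \<comment> \<open>The monomial is unbounded, so \<open>g\<close> divided by it tends to \<open>0\<close>, not to \<open>c\<close>.\<close>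
    have "((\<lambda>t. \<bar>g t / log_monom s t\<bar>) \<longlongrightarrow> \<bar>c\<bar>) (at_right 0)"
      by (intro tendsto_intros lim)
    moreover have "((\<lambda>t. \<bar>C\<bar> * \<bar>log_monom (0 - s) t\<bar>) \<longlongrightarrow> \<bar>C\<bar> * \<bar>0\<bar>) (at_right 0)"
      by (intro tendsto_intros log_monom_tendsto_0 3)
    moreover have "\<forall>\<^sub>F t in at_right 0. \<bar>g t / log_monom s t\<bar> \<le> \<bar>C\<bar> * \<bar>log_monom (0 - s) t\<bar>"
      using bdd eventually_unit_interval
    proof eventually_elim
      case (elim t)
      have "log_monom (0 - s) t = 1 / log_monom s t"
        using elim log_monom_diff[of t 0 s] by (simp add: log_monom_def)
      then show ?case using elim by (simp add: abs_mult divide_right_mono)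
    qed
    ultimately have "\<bar>c\<bar> \<le> \<bar>C\<bar> * \<bar>0\<bar>"
      by (intro tendsto_le[OF trivial_limit_at_right_real])
    then show ?thesis using c by simp
  qed
qed

text \<open>
  This is how boundedness of a rational function yields its limit along a test curve:
  numerator and denominator restricted to the curve are sums of logarithmic monomials, so their
  quotient is zero or behaves like a single monomial.
\<close>

lemma bounded_log_sum_quotient_convergent:
  assumes P: "P \<in> log_sums A" and Q: "Q \<in> log_sums A"
    and nz: "\<forall>\<^sub>F t in at_right 0. Q t \<noteq> 0"
    and bdd: "\<forall>\<^sub>F t in at_right 0. \<bar>P t / Q t\<bar> \<le> C"
  shows "\<exists>l. ((\<lambda>t. P t / Q t) \<longlongrightarrow> l) (at_right 0)"
proof (cases "\<forall>t\<in>{0<..<1}. P t = 0")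
  case True
  have "((\<lambda>t. P t / Q t) \<longlongrightarrow> 0) (at_right 0)"
    by (intro tendsto_eventually eventually_mono[OF eventually_unit_interval]) (use True in auto)
  then show ?thesis by blast
next
  case False
  then obtain p c where p: "c \<noteq> 0" "((\<lambda>t. P t / log_monom p t) \<longlongrightarrow> c) (at_right 0)"
    using log_sums_leading_term[OF P] by blast
  have "\<not> (\<forall>t\<in>{0<..<1}. Q t = 0)"
    using eventually_happens[OF eventually_conj[OF nz eventually_unit_interval]] by auto
  then obtain q d where q: "d \<noteq> 0" "((\<lambda>t. Q t / log_monom q t) \<longlongrightarrow> d) (at_right 0)"
    using log_sums_leading_term[OF Q] by blast
  have "\<forall>\<^sub>F t in at_right 0. (P t / log_monom p t) / (Q t / log_monom q t) = (P t / Q t) / log_monom (p - q) t"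
    using eventually_unit_interval
    by eventually_elim (simp add: log_monom_diff)
  moreover have "((\<lambda>t. (P t / log_monom p t) / (Q t / log_monom q t)) \<longlongrightarrow> c / d) (at_right 0)"
    by (intro tendsto_divide p q)
  ultimately have "((\<lambda>t. (P t / Q t) / log_monom (p - q) t) \<longlongrightarrow> c / d) (at_right 0)"
    by (simp add: tendsto_cong)
  then show ?thesis
    by (rule bounded_log_monom_like_convergent[OF _ _ bdd]) (use p q in auto)
qed

section \<open>Bivariate polynomials along a curve\<close>

lemma poly_xy_0 [simp]: "poly_xy 0 x y = 0"
  by (simp add: poly_xy_def)

lemma poly_xy_pCons [simp]: "poly_xy (pCons a p) x y = poly a x + y * poly_xy p x y"
  by (simp add: poly_xy_def)

lemma poly_xy_add [simp]: "poly_xy (p + q) x y = poly_xy p x y + poly_xy q x y"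
  by (simp add: poly_xy_def)

lemma poly_xy_mult [simp]: "poly_xy (p * q) x y = poly_xy p x y * poly_xy q x y"
  by (simp add: poly_xy_def)

lemma poly_xy_1 [simp]: "poly_xy 1 x y = 1"
  by (simp add: poly_xy_def)

lemma log_sums_poly:
  assumes A: "\<And>r s. r \<in> A \<Longrightarrow> s \<in> A \<Longrightarrow> r + s \<in> A" "(0, 0) \<in> A" and h: "h \<in> log_sums A"
  shows "(\<lambda>t. poly p (h t)) \<in> log_sums A"
proof (induction p)
  case 0
  then show ?case by (simp add: log_sums_zero)
next
  case (pCons a p)
  have "(\<lambda>t. a) \<in> log_sums A"
    by (rule log_sums_cong[OF log_sums_monom[OF A(2), of a]]) (simp add: log_monom_def)
  from log_sums_add[OF this log_sums_mult[OF A(1) h pCons(2)]] show ?case by simp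
qed

lemma log_sums_poly_xy:
  assumes A: "\<And>r s. r \<in> A \<Longrightarrow> s \<in> A \<Longrightarrow> r + s \<in> A" "(0, 0) \<in> A"
    and g: "g \<in> log_sums A" and h: "h \<in> log_sums A"
  shows "(\<lambda>t. poly_xy p (g t) (h t)) \<in> log_sums A"
proof (induction p)
  case 0
  then show ?case by (simp add: log_sums_zero)
next
  case (pCons a p)
  from log_sums_add[OF log_sums_poly[OF A g] log_sums_mult[OF A(1) h pCons(2)]]
  show ?case by simp
qed

lemma log_sums_ident:
  assumes "(1, 0) \<in> A" shows "(\<lambda>t. t) \<in> log_sums A"
  by (rule log_sums_cong[OF log_sums_monom[OF assms, of 1]]) (simp add: log_monom_def)

lemma log_sums_Phi:
  assumes "\<And>k. k \<in> {1..N} \<Longrightarrow> (e k, 0) \<in> A"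
  shows "Phi N \<phi> e \<in> log_sums A"
proof -
  have "(\<lambda>t. \<Sum>k=1..N. \<phi> k * log_monom (e k, 0) t) \<in> log_sums A"
    by (intro log_sums_sum log_sums_monom assms)
  then show ?thesis by (rule log_sums_cong) (simp add: log_monom_def Phi_def)
qed

lemma test_fun_log_sums: "test_fun h \<Longrightarrow> h \<in> log_sums UNIV"
proof (induction rule: test_fun.induct)
  case (irrational N \<phi> e a)
  have "(\<lambda>t. Phi N \<phi> e t + 1 * log_monom (a, 0) t) \<in> log_sums UNIV"
    by (intro log_sums_add log_sums_Phi log_sums_monom) auto
  then show ?case by (rule log_sums_cong) (simp add: log_monom_def)
next
  case (div_ln N \<phi> e a)
  have "(\<lambda>t. Phi N \<phi> e t + 1 * log_monom (a, -1) t) \<in> log_sums UNIV"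
    by (intro log_sums_add log_sums_Phi log_sums_monom) auto
  then show ?case by (rule log_sums_cong) (simp add: log_monom_def divide_inverse)
next
  case (times_ln N \<phi> e a)
  have "(\<lambda>t. Phi N \<phi> e t + 1 * log_monom (a, 1) t) \<in> log_sums UNIV"
    by (intro log_sums_add log_sums_Phi log_sums_monom) auto
  then show ?case by (rule log_sums_cong) (simp add: log_monom_def)
qed (auto intro: log_sums_Phi)

section \<open>Leading powers\<close>

definition leading_power :: "(real \<Rightarrow> real) \<Rightarrow> real \<Rightarrow> real \<Rightarrow> bool" where
  "leading_power g c a \<longleftrightarrow> c \<noteq> 0 \<and> ((\<lambda>t. g t / t powr a) \<longlongrightarrow> c) (at_right 0)"

lemma powr_tendsto_0_at_right: "a > 0 \<Longrightarrow> ((\<lambda>t::real. t powr a) \<longlongrightarrow> 0) (at_right 0)"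
  by real_asymp

lemma tendsto_0_powr_divide:
  fixes g :: "real \<Rightarrow> real"
  assumes g: "((\<lambda>t. g t / t powr a) \<longlongrightarrow> c) (at_right 0)" and ba: "b < a"
  shows "((\<lambda>t. g t / t powr b) \<longlongrightarrow> 0) (at_right 0)"
proof -
  have "\<forall>\<^sub>F t in at_right 0. (g t / t powr a) * t powr (a - b) = g t / t powr b"
    using eventually_unit_interval by eventually_elim (simp add: powr_diff)
  moreover have "((\<lambda>t. (g t / t powr a) * t powr (a - b)) \<longlongrightarrow> c * 0) (at_right 0)"
    by (intro tendsto_mult g powr_tendsto_0_at_right) (use ba in simp)
  ultimately show ?thesis by (simp add: tendsto_cong)
qed

lemma leading_power_unique:
  assumes "leading_power g c a" "leading_power g d b" shows "a = b"
proof (rule ccontr)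
  assume "a \<noteq> b"
  then consider "a < b" | "b < a" by linarith
  then show False
  proof cases
    case 1
    then have "((\<lambda>t. g t / t powr a) \<longlongrightarrow> 0) (at_right 0)"
      using assms(2) tendsto_0_powr_divide unfolding leading_power_def by blast
    then show False using assms(1) tendsto_unique[OF trivial_limit_at_right_real]
      unfolding leading_power_def by blast
  next
    case 2
    then have "((\<lambda>t. g t / t powr b) \<longlongrightarrow> 0) (at_right 0)"
      using assms(1) tendsto_0_powr_divide unfolding leading_power_def by blast
    then show False using assms(2) tendsto_unique[OF trivial_limit_at_right_real]
      unfolding leading_power_def by blast
  qed
qed

lemma leading_power_not_zero:
  assumes "leading_power g c a" shows "\<not> (\<forall>t\<in>{0<..<1}. g t = 0)"
proof
  assume "\<forall>t\<in>{0<..<1}. g t = 0"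
  then have "((\<lambda>t. g t / t powr a) \<longlongrightarrow> 0) (at_right 0)"
    by (intro tendsto_eventually eventually_mono[OF eventually_unit_interval]) auto
  then show False
    using assms tendsto_unique[OF trivial_limit_at_right_real] unfolding leading_power_def by blast
qed

definition power_lattice :: "nat \<Rightarrow> (real \<times> int) set" where
  "power_lattice D = {(a, 0) | a. a * real D \<in> \<int>}"

lemma power_lattice_add: "r \<in> power_lattice D \<Longrightarrow> s \<in> power_lattice D \<Longrightarrow> r + s \<in> power_lattice D"
  by (auto simp: power_lattice_def distrib_right)

lemma power_lattice_simps: "(a, 0) \<in> power_lattice D \<longleftrightarrow> a * real D \<in> \<int>"
  by (simp add: power_lattice_def)

lemma log_sums_power_lattice_leading_power:
  assumes "g \<in> log_sums (power_lattice D)"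
  shows "(\<forall>t\<in>{0<..<1}. g t = 0) \<or> (\<exists>c a. leading_power g c a \<and> a * real D \<in> \<int>)"
  using log_sums_leading_term[OF assms]
  by (auto simp: leading_power_def power_lattice_def log_monom_def)

lemma poly_xy_power_lattice:
  assumes "\<And>k. k \<in> {1..N} \<Longrightarrow> e k * real D \<in> \<int>"
  shows "(\<lambda>t. poly_xy p t (Phi N \<phi> e t)) \<in> log_sums (power_lattice D)"
  by (intro log_sums_poly_xy log_sums_ident log_sums_Phi power_lattice_add)
    (use assms in \<open>auto simp: power_lattice_simps\<close>)

lemma common_denominator:
  assumes "\<And>k. k \<in> {1..N::nat} \<Longrightarrow> (e k :: real) \<in> \<rat>"
  shows "\<exists>D>0. \<forall>k\<in>{1..N}. e k * real D \<in> \<int>"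
  using assms
proof (induction N)
  case 0
  then show ?case by (intro exI[of _ 1]) simp
next
  case (Suc N)
  then obtain D where D: "D > 0" "\<And>k. k \<in> {1..N} \<Longrightarrow> e k * real D \<in> \<int>" by auto
  have "e (Suc N) \<in> \<rat>" using Suc.prems by simp
  then obtain a b where ab: "b > 0" "e (Suc N) = of_int a / of_int b"
    using Rats_cases' by metis
  have "e k * real (D * nat b) \<in> \<int>" if "k \<in> {1..Suc N}" for k
  proof (cases "k = Suc N")
    case True
    have "e k * real (D * nat b) = of_int (a * int D)" using True ab by simp
    then show ?thesis by (metis Ints_of_int)
  next
    case False
    have "e k * real (D * nat b) = (e k * real D) * real (nat b)" by simp
    moreover have "e k * real D \<in> \<int>" using D(2) that False by simp
    ultimately show ?thesis by (metis Ints_mult Ints_of_nat)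
  qed
  then show ?case using D ab by (intro exI[of _ "D * nat b"]) auto
qed

section \<open>Stability of leading terms along a series of powers\<close>

definition bounded_by_power :: "(real \<Rightarrow> real) \<Rightarrow> real \<Rightarrow> bool" where
  "bounded_by_power s a \<longleftrightarrow> (\<exists>C. \<forall>\<^sub>F t in at_right 0. \<bar>s t\<bar> \<le> C * t powr a)"

lemma bounded_by_power_0: "bounded_by_power (\<lambda>t. 0) a"
  unfolding bounded_by_power_def by (intro exI[of _ 0]) simp

lemma bounded_by_power_monomial: "bounded_by_power (\<lambda>t. c * \<bar>t\<bar> powr a) a"
  unfolding bounded_by_power_def
  by (intro exI[of _ "\<bar>c\<bar>"] eventually_mono[OF eventually_unit_interval]) (simp add: abs_mult)

lemma bounded_by_power_mono:
  assumes "bounded_by_power s a" "b \<le> a" shows "bounded_by_power s b"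
proof -
  obtain C where C: "\<forall>\<^sub>F t in at_right 0. \<bar>s t\<bar> \<le> C * t powr a"
    using assms unfolding bounded_by_power_def by blast
  have "\<forall>\<^sub>F t in at_right 0. \<bar>s t\<bar> \<le> \<bar>C\<bar> * t powr b"
    using C eventually_unit_interval
  proof eventually_elim
    case (elim t)
    have "C * t powr a \<le> \<bar>C\<bar> * t powr b"
      using elim assms(2) by (intro mult_mono powr_mono') auto
    then show ?case using elim by simp
  qed
  then show ?thesis unfolding bounded_by_power_def by blast
qed

lemma bounded_by_power_add:
  assumes "bounded_by_power r a" "bounded_by_power s a"
  shows "bounded_by_power (\<lambda>t. r t + s t) a"
proof -
  obtain C where C: "\<forall>\<^sub>F t in at_right 0. \<bar>r t\<bar> \<le> C * t powr a"
    using assms unfolding bounded_by_power_def by blast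
  obtain D where D: "\<forall>\<^sub>F t in at_right 0. \<bar>s t\<bar> \<le> D * t powr a"
    using assms unfolding bounded_by_power_def by blast
  have "\<forall>\<^sub>F t in at_right 0. \<bar>r t + s t\<bar> \<le> (C + D) * t powr a"
    using C D by eventually_elim (simp add: distrib_right)
  then show ?thesis unfolding bounded_by_power_def by blast
qed

lemma bounded_by_power_dominated:
  assumes "bounded_by_power s a" "\<And>t. \<bar>r t\<bar> \<le> \<bar>s t\<bar>"
  shows "bounded_by_power r a"
proof -
  obtain C where C: "\<forall>\<^sub>F t in at_right 0. \<bar>s t\<bar> \<le> C * t powr a"
    using assms unfolding bounded_by_power_def by blast
  have "\<forall>\<^sub>F t in at_right 0. \<bar>r t\<bar> \<le> C * t powr a"
    using C by eventually_elim (rule order_trans[OF assms(2)])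
  then show ?thesis unfolding bounded_by_power_def by blast
qed

text \<open>
  If $s = O(t^a)$ and $g$ is of order $t^w$, then $s g$ is of order at least $w + a$.
  Together with the mean value theorem this controls how a polynomial changes when its second
  argument is perturbed.
\<close>

lemma bounded_by_power_small:
  fixes g :: "real \<Rightarrow> real"
  assumes s: "bounded_by_power s a" and g: "((\<lambda>t. g t / t powr w) \<longlongrightarrow> c) (at_right 0)" and r: "r < w + a"
  shows "((\<lambda>t. s t * g t / t powr r) \<longlongrightarrow> 0) (at_right 0)"
proof -
  obtain C where C: "\<forall>\<^sub>F t in at_right 0. \<bar>s t\<bar> \<le> C * t powr a"
    using s unfolding bounded_by_power_def by blast
  have "((\<lambda>t. C * \<bar>g t / t powr w\<bar> * t powr (w + a - r)) \<longlongrightarrow> C * \<bar>c\<bar> * 0) (at_right 0)"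
    by (intro tendsto_intros g powr_tendsto_0_at_right) (use r in simp)
  then have lim: "((\<lambda>t. C * \<bar>g t / t powr w\<bar> * t powr (w + a - r)) \<longlongrightarrow> 0) (at_right 0)"
    by simp
  have "\<forall>\<^sub>F t in at_right 0. norm (s t * g t / t powr r) \<le> C * \<bar>g t / t powr w\<bar> * t powr (w + a - r)"
    using C eventually_unit_interval
  proof eventually_elim
    case (elim t)
    have "norm (s t * g t / t powr r) = \<bar>s t\<bar> * (\<bar>g t\<bar> / t powr r)"
      using elim by (simp add: abs_mult)
    also have "\<dots> \<le> (C * t powr a) * (\<bar>g t\<bar> / t powr r)"
      using elim by (intro mult_right_mono) auto
    also have "\<dots> = C * \<bar>g t / t powr w\<bar> * t powr (w + a - r)"
      using elim by (simp add: powr_diff powr_add)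
    finally show ?case .
  qed
  then show ?thesis using lim by (rule Lim_null_comparison)
qed

lemma Phi_Suc: "Phi (Suc N) \<phi> e t = Phi N \<phi> e t + \<phi> (Suc N) * \<bar>t\<bar> powr e (Suc N)"
  by (simp add: Phi_def)

lemma type_II_strict_mono: "type_II \<phi> e \<Longrightarrow> 1 \<le> j \<Longrightarrow> j < k \<Longrightarrow> e j < e k"
  unfolding type_II_def type_I_def strict_mono_on_def
  by (metis atLeastAtMost_iff less_imp_le order_refl order_trans)

lemma type_II_D:
  assumes "type_II \<phi> e" "1 \<le> k" shows "\<phi> k \<noteq> 0" "e k \<in> \<rat>" "1 \<le> e k"
proof -
  have "type_I k \<phi> e" using assms(1) unfolding type_II_def by blast
  then show "\<phi> k \<noteq> 0" "e k \<in> \<rat>" "1 \<le> e k" using assms(2) unfolding type_I_def by auto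
qed

lemma Phi_diff_bounded_by_power:
  assumes "type_II \<phi> e" "N \<le> M"
  shows "bounded_by_power (\<lambda>t. Phi M \<phi> e t - Phi N \<phi> e t) (e (Suc N))"
  using assms(2)
proof (induction rule: dec_induct)
  case base
  then show ?case by (simp add: bounded_by_power_0)
next
  case (step M)
  have "e (Suc N) \<le> e (Suc M)"
    using type_II_strict_mono[OF assms(1), of "Suc N" "Suc M"] step by (cases "N = M") auto
  from bounded_by_power_add[OF step(3) bounded_by_power_mono[OF bounded_by_power_monomial this, of "\<phi> (Suc M)"]]
  show ?case by (simp add: Phi_Suc algebra_simps)
qed

lemma poly_xy_has_field_derivative:
  "((\<lambda>u. poly_xy p t u) has_field_derivative poly_xy (pderiv p) t u) (at u within S)"
proof (induction p)
  case 0
  then show ?case by simp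
next
  case (pCons a p)
  show ?case
    by (rule derivative_eq_intros pCons refl | simp add: pderiv_pCons)+
qed

text \<open>
  The mean value theorem in the second variable, stated so that the intermediate point is
  again a perturbation of the base point which is no larger than the given one.
\<close>

lemma poly_xy_mean_value:
  "\<exists>v. \<bar>v\<bar> \<le> \<bar>s\<bar> \<and> poly_xy p t (u + s) - poly_xy p t u = s * poly_xy (pderiv p) t (u + v)"
proof (cases s "0 :: real" rule: linorder_cases)
  case less
  from MVT2[of "u + s" u "\<lambda>u. poly_xy p t u" "\<lambda>u. poly_xy (pderiv p) t u"] less
  obtain z where z: "u + s < z" "z < u"
      "poly_xy p t u - poly_xy p t (u + s) = (u - (u + s)) * poly_xy (pderiv p) t z"
    using poly_xy_has_field_derivative by auto
  then show ?thesis using less by (intro exI[of _ "z - u"]) auto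
next
  case greater
  from MVT2[of u "u + s" "\<lambda>u. poly_xy p t u" "\<lambda>u. poly_xy (pderiv p) t u"] greater
  obtain z where z: "u < z" "z < u + s"
      "poly_xy p t (u + s) - poly_xy p t u = (u + s - u) * poly_xy (pderiv p) t z"
    using poly_xy_has_field_derivative by auto
  then show ?thesis using greater by (intro exI[of _ "z - u"]) auto
qed (auto intro: exI[of _ 0])

lemma poly_xy_mean_value_curve:
  "\<exists>v. (\<forall>t. \<bar>v t\<bar> \<le> \<bar>s t\<bar>) \<and>
     (\<forall>t. poly_xy p t (u t + s t) - poly_xy p t (u t) = s t * poly_xy (pderiv p) t (u t + v t))"
proof -
  have "\<forall>t. \<exists>v. \<bar>v\<bar> \<le> \<bar>s t\<bar> \<and>
      poly_xy p t (u t + s t) - poly_xy p t (u t) = s t * poly_xy (pderiv p) t (u t + v)"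
    using poly_xy_mean_value by blast
  from choice[OF this] show ?thesis by blast
qed

text \<open>
  From index \<open>N0\<close> on, \<open>R\<close> has the same leading term \<open>c * t powr w\<close> along all partial sums,
  and this leading term even survives arbitrary perturbations of the size of the next term of the
  series. The perturbations are included so that the mean value theorem, which evaluates the
  derivative at an unspecified intermediate point, can be applied to a stable derivative.
\<close>

definition stable_along :: "(nat \<Rightarrow> real) \<Rightarrow> (nat \<Rightarrow> real) \<Rightarrow> real poly poly \<Rightarrow> real \<Rightarrow> real \<Rightarrow> nat \<Rightarrow> bool" where
  "stable_along \<phi> e R c w N0 \<longleftrightarrow> c \<noteq> 0 \<and> (\<forall>N\<ge>N0. \<forall>s. bounded_by_power s (e (Suc N)) \<longrightarrow>
     ((\<lambda>t. poly_xy R t (Phi N \<phi> e t + s t) / t powr w) \<longlongrightarrow> c) (at_right 0))"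

lemma stable_along_leading_power:
  assumes "stable_along \<phi> e R c w N0" "N \<ge> N0"
  shows "leading_power (\<lambda>t. poly_xy R t (Phi N \<phi> e t)) c w"
  using assms bounded_by_power_0[of "e (Suc N)"]
  unfolding stable_along_def leading_power_def by fastforce

text \<open>
  All later changes of the argument have size $O(t^{e_{N+1}})$, hence change \<open>R\<close> by
  $O(t^{w + e_{N+1}})$ if its derivative has order $w$ nearby. If the order \<open>r\<close> of \<open>R\<close> at stage \<open>N\<close>
  is smaller than $w + e_{N+1}$, these changes never reach the leading term.
\<close>

lemma stable_along_of_derivative:
  assumes II: "type_II \<phi> e"
    and D: "stable_along \<phi> e (pderiv R) c w N0" and N: "N \<ge> N0"
    and lead: "leading_power (\<lambda>t. poly_xy R t (Phi N \<phi> e t)) b r" and r: "r < w + e (Suc N)"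
  shows "stable_along \<phi> e R b r N"
  unfolding stable_along_def
proof (intro conjI allI impI)
  show "b \<noteq> 0" using lead unfolding leading_power_def by blast
  fix M s assume M: "N \<le> M" and s: "bounded_by_power s (e (Suc M))"
  define d where "d t = (Phi M \<phi> e t - Phi N \<phi> e t) + s t" for t
  have "e (Suc N) \<le> e (Suc M)"
    using type_II_strict_mono[OF II, of "Suc N" "Suc M"] M by (cases "N = M") auto
  then have d: "bounded_by_power d (e (Suc N))"
    unfolding d_def
    by (intro bounded_by_power_add Phi_diff_bounded_by_power II M bounded_by_power_mono[OF s])
  obtain v where v: "\<And>t. \<bar>v t\<bar> \<le> \<bar>d t\<bar>" and mv: "\<And>t. poly_xy R t (Phi N \<phi> e t + d t)
      - poly_xy R t (Phi N \<phi> e t) = d t * poly_xy (pderiv R) t (Phi N \<phi> e t + v t)"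
    using poly_xy_mean_value_curve[of d R "Phi N \<phi> e"] by blast
  have "((\<lambda>t. poly_xy (pderiv R) t (Phi N \<phi> e t + v t) / t powr w) \<longlongrightarrow> c) (at_right 0)"
    using D N bounded_by_power_dominated[OF d v] unfolding stable_along_def by blast
  from bounded_by_power_small[OF d this r]
  have "((\<lambda>t. (poly_xy R t (Phi N \<phi> e t + d t) - poly_xy R t (Phi N \<phi> e t)) / t powr r)
      \<longlongrightarrow> 0) (at_right 0)" by (simp add: mv)
  from tendsto_add[OF this] lead
  have "((\<lambda>t. (poly_xy R t (Phi N \<phi> e t + d t) - poly_xy R t (Phi N \<phi> e t)) / t powr r
      + poly_xy R t (Phi N \<phi> e t) / t powr r) \<longlongrightarrow> 0 + b) (at_right 0)"
    unfolding leading_power_def by blast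
  then show "((\<lambda>t. poly_xy R t (Phi M \<phi> e t + s t) / t powr r) \<longlongrightarrow> b) (at_right 0)"
    by (simp add: d_def diff_divide_distrib)
qed

text \<open>
  If, on the contrary, \<open>R\<close> is negligible at stage \<open>N\<close>, then the change caused by the next
  term of the series is what remains, and it has order exactly $w + e_{N+1}$.
\<close>

lemma leading_power_next:
  assumes II: "type_II \<phi> e"
    and D: "stable_along \<phi> e (pderiv R) c w N0" and N: "N \<ge> N0"
    and zero: "((\<lambda>t. poly_xy R t (Phi N \<phi> e t) / t powr (w + e (Suc N))) \<longlongrightarrow> 0) (at_right 0)"
  shows "leading_power (\<lambda>t. poly_xy R t (Phi (Suc N) \<phi> e t)) (c * \<phi> (Suc N)) (w + e (Suc N))"
proof -
  define d where "d t = \<phi> (Suc N) * \<bar>t\<bar> powr e (Suc N)" for t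
  have d: "bounded_by_power d (e (Suc N))"
    unfolding d_def by (rule bounded_by_power_monomial)
  obtain v where v: "\<And>t. \<bar>v t\<bar> \<le> \<bar>d t\<bar>" and mv: "\<And>t. poly_xy R t (Phi N \<phi> e t + d t)
      - poly_xy R t (Phi N \<phi> e t) = d t * poly_xy (pderiv R) t (Phi N \<phi> e t + v t)"
    using poly_xy_mean_value_curve[of d R "Phi N \<phi> e"] by blast
  have lim: "((\<lambda>t. poly_xy (pderiv R) t (Phi N \<phi> e t + v t) / t powr w) \<longlongrightarrow> c) (at_right 0)"
    using D N bounded_by_power_dominated[OF d v] unfolding stable_along_def by blast
  have eq: "\<forall>\<^sub>F t in at_right 0.
      poly_xy R t (Phi N \<phi> e t) / t powr (w + e (Suc N)) +
      \<phi> (Suc N) * (poly_xy (pderiv R) t (Phi N \<phi> e t + v t) / t powr w)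
      = poly_xy R t (Phi (Suc N) \<phi> e t) / t powr (w + e (Suc N))"
    using eventually_unit_interval
  proof eventually_elim
    case (elim t)
    have "poly_xy R t (Phi (Suc N) \<phi> e t) = poly_xy R t (Phi N \<phi> e t)
        + d t * poly_xy (pderiv R) t (Phi N \<phi> e t + v t)"
      using mv[of t] by (simp add: Phi_Suc d_def)
    then show ?case using elim by (simp add: d_def add_divide_distrib powr_add)
  qed
  have "((\<lambda>t. poly_xy R t (Phi N \<phi> e t) / t powr (w + e (Suc N)) +
      \<phi> (Suc N) * (poly_xy (pderiv R) t (Phi N \<phi> e t + v t) / t powr w))
      \<longlongrightarrow> 0 + \<phi> (Suc N) * c) (at_right 0)"
    by (intro tendsto_intros zero lim)
  then have "((\<lambda>t. poly_xy R t (Phi (Suc N) \<phi> e t) / t powr (w + e (Suc N)))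
      \<longlongrightarrow> c * \<phi> (Suc N)) (at_right 0)"
    using eq by (simp add: tendsto_cong mult.commute)
  moreover have "c \<noteq> 0" using D unfolding stable_along_def by blast
  ultimately show ?thesis
    using type_II_D(1)[OF II, of "Suc N"] unfolding leading_power_def by simp
qed

text \<open>
  The numbers $D e_k$ form a strictly increasing sequence of integers.
\<close>

lemma lattice_exponents_unbounded:
  assumes II: "type_II \<phi> e" and D: "D > 0" and Z: "\<And>k. k \<ge> 1 \<Longrightarrow> e k * real D \<in> \<int>"
  shows "filterlim e at_top sequentially"
proof -
  have "e k * real D \<ge> real k" if "k \<ge> 1" for k
    using that
  proof (induction rule: dec_induct)
    case base
    have "1 * 1 \<le> e 1 * real D"
      using type_II_D(3)[OF II, of 1] D by (intro mult_mono) auto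
    then show ?case by simp
  next
    case (step k)
    obtain i where i: "e k * real D = of_int i" using Z step by (auto elim: Ints_cases)
    obtain j where j: "e (Suc k) * real D = of_int j" using Z[of "Suc k"] by (auto elim: Ints_cases)
    have "e k * real D < e (Suc k) * real D"
      using type_II_strict_mono[OF II, of k "Suc k"] step D by simp
    then have "i + 1 \<le> j" using i j by simp
    then have "of_int i + 1 \<le> (of_int j :: real)" by linarith
    then show ?case using step i j by simp
  qed
  then have "\<forall>\<^sub>F k in sequentially. real k / real D \<le> e k"
    using D by (intro eventually_sequentiallyI[of 1]) (simp add: field_simps)
  moreover have "filterlim (\<lambda>k. real k / real D) at_top sequentially"
    using D by real_asymp
  ultimately show ?thesis by (rule filterlim_at_top_mono[rotated])
qed

text \<open>
  This replaces the Newton-Puiseux theorem: a series that agrees with a root of \<open>R\<close> to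
  infinite order must have exponents with bounded denominators. The proof is an induction on
  the degree in the second variable; in degree \<open>0\<close> nothing depends on the series.
  Otherwise let the derivative of \<open>R\<close> be stable of order \<open>w\<close>, and let $r_N$ be
  the order of \<open>R\<close> at stage \<open>N\<close>. If $r_N < w + e_{N+1}$ for some \<open>N\<close>, then \<open>R\<close> is stable;
  if $r_N > w + e_{N+1}$ or \<open>R\<close> vanishes at stage \<open>N\<close>, then the strict inequality holds at stage
  $N + 1$. So instability forces $e_{N+1} = r_N - w$ for all large \<open>N\<close>. But $r_N$ has the
  denominators of $1, e_1, \dots, e_N$ and $w$ those of $1, e_1, \dots, e_{N_0}$, so no new denominators
  ever appear. Exponents in a lattice are unbounded.
\<close>

lemma stable_along_or_exponents_unbounded:
  assumes II: "type_II \<phi> e" and "R \<noteq> 0"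
  shows "(\<exists>c w N0. stable_along \<phi> e R c w N0) \<or> filterlim e at_top sequentially"
  using assms(2)
proof (induction "degree R" arbitrary: R rule: less_induct)
  case less
  have lattice: "(\<lambda>t. poly_xy R t (Phi N \<phi> e t)) \<in> log_sums (power_lattice D)"
    if "\<And>k. k \<in> {1..N} \<Longrightarrow> e k * real D \<in> \<int>" for R N D
    by (rule poly_xy_power_lattice[OF that])
  show ?case
  proof (cases "pderiv R = 0")
    case True
    then obtain a where a: "R = [:a:]" "a \<noteq> 0"
      using less(2) by (auto simp: pderiv_eq_0_iff elim: degree_eq_zeroE)
    have R: "poly_xy R t u = poly a t" for t u by (simp add: a)
    have "(\<lambda>t. poly_xy R t (Phi 0 \<phi> e t)) \<in> log_sums (power_lattice 1)"
      by (rule lattice) simp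
    moreover have "\<not> (\<forall>t\<in>{0<..<1}. poly_xy R t (Phi 0 \<phi> e t) = 0)"
    proof
      assume "\<forall>t\<in>{0<..<1}. poly_xy R t (Phi 0 \<phi> e t) = 0"
      then have "{0<..<1} \<subseteq> {t::real. poly a t = 0}" by (auto simp: R)
      from finite_subset[OF this poly_roots_finite[OF a(2)]] show False
        using infinite_Ioo[of "0::real" 1] by simp
    qed
    ultimately obtain c w where "leading_power (\<lambda>t. poly_xy R t (Phi 0 \<phi> e t)) c w"
      using log_sums_power_lattice_leading_power by blast
    then have "stable_along \<phi> e R c w 0"
      unfolding stable_along_def leading_power_def by (simp add: R)
    then show ?thesis by blast
  next
    case False
    then have "degree R \<noteq> 0" by (simp add: pderiv_eq_0_iff)
    then have "degree (pderiv R) < degree R" by (simp add: degree_pderiv)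
    from less(1)[OF this False] consider "filterlim e at_top sequentially"
      | c w N0 where "stable_along \<phi> e (pderiv R) c w N0" by blast
    then show ?thesis
    proof cases
      case 1
      then show ?thesis by blast
    next
      case (2 c w N0)
      note D = this
      show ?thesis
      proof (rule ccontr)
        assume unstable: "\<not> ?thesis"
        have order_ge: "w + e (Suc N) \<le> r"
          if "leading_power (\<lambda>t. poly_xy R t (Phi N \<phi> e t)) b r" "N \<ge> N0" for N b r
          using stable_along_of_derivative[OF II D that(2,1)] unstable by force
        have not_negligible: "\<not> ((\<lambda>t. poly_xy R t (Phi N \<phi> e t) / t powr (w + e (Suc N))) \<longlongrightarrow> 0) (at_right 0)"
          if "N \<ge> N0" for N
        proof
          assume "((\<lambda>t. poly_xy R t (Phi N \<phi> e t) / t powr (w + e (Suc N))) \<longlongrightarrow> 0) (at_right 0)"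
          from order_ge[OF leading_power_next[OF II D that this]] that
          have "e (Suc (Suc N)) \<le> e (Suc N)" by simp
          then show False using type_II_strict_mono[OF II, of "Suc N" "Suc (Suc N)"] by simp
        qed
        have nonzero: "\<not> (\<forall>t\<in>{0<..<1}. poly_xy R t (Phi N \<phi> e t) = 0)" if "N \<ge> N0" for N
        proof
          assume "\<forall>t\<in>{0<..<1}. poly_xy R t (Phi N \<phi> e t) = 0"
          then have "((\<lambda>t. poly_xy R t (Phi N \<phi> e t) / t powr (w + e (Suc N))) \<longlongrightarrow> 0) (at_right 0)"
            by (intro tendsto_eventually eventually_mono[OF eventually_unit_interval]) auto
          then show False using not_negligible that by blast
        qed
        \<comment> \<open>With both inequalities excluded, the order is determined at every stage.\<close>
        have exact: "r = w + e (Suc N)"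
          if "leading_power (\<lambda>t. poly_xy R t (Phi N \<phi> e t)) b r" "N \<ge> N0" for N b r
        proof (rule ccontr)
          assume "r \<noteq> w + e (Suc N)"
          then have "w + e (Suc N) < r" using order_ge[OF that] by simp
          moreover have "((\<lambda>t. poly_xy R t (Phi N \<phi> e t) / t powr r) \<longlongrightarrow> b) (at_right 0)"
            using that(1) unfolding leading_power_def by blast
          ultimately show False
            using not_negligible[OF that(2)] tendsto_0_powr_divide[of "\<lambda>t. poly_xy R t (Phi N \<phi> e t)"] by blast
        qed
        obtain D0 where D0: "D0 > 0" "\<And>k. k \<in> {1..N0} \<Longrightarrow> e k * real D0 \<in> \<int>"
          using common_denominator[of N0 e] type_II_D(2)[OF II] by auto
        \<comment> \<open>The order of the derivative is already visible at stage \<open>N0\<close>.\<close>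
        have w: "w * real D0 \<in> \<int>"
        proof -
          have L: "leading_power (\<lambda>t. poly_xy (pderiv R) t (Phi N0 \<phi> e t)) c w"
            by (rule stable_along_leading_power[OF D order_refl])
          then obtain b r where "leading_power (\<lambda>t. poly_xy (pderiv R) t (Phi N0 \<phi> e t)) b r"
              "r * real D0 \<in> \<int>"
            using log_sums_power_lattice_leading_power[OF lattice[OF D0(2), where R = "pderiv R"]]
              leading_power_not_zero by blast
          then show ?thesis using leading_power_unique[OF L] by blast
        qed
        have all: "\<forall>k\<in>{1..N}. e k * real D0 \<in> \<int>" if "N \<ge> N0" for N
          using that
        proof (induction rule: dec_induct)
          case base
          then show ?case using D0 by blast
        next
          case (step N)
          obtain b r where "leading_power (\<lambda>t. poly_xy R t (Phi N \<phi> e t)) b r" "r * real D0 \<in> \<int>"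
            using log_sums_power_lattice_leading_power[OF lattice, of N D0 R] step nonzero by blast
          then have "(w + e (Suc N)) * real D0 \<in> \<int>" using exact step by blast
          from Ints_diff[OF this w] have "e (Suc N) * real D0 \<in> \<int>" by (simp add: distrib_right)
          then show ?case using step by (auto simp: le_Suc_eq)
        qed
        have "filterlim e at_top sequentially"
        proof (rule lattice_exponents_unbounded[OF II D0(1)])
          fix k :: nat assume "k \<ge> 1"
          then show "e k * real D0 \<in> \<int>" using all[of "max k N0"] by simp
        qed
        then show False using unstable by blast
      qed
    qed
  qed
qed

section \<open>Limits of a quotient along the partial sums of a series\<close>

lemma tendsto_poly_xy:
  "(g \<longlongrightarrow> a) F \<Longrightarrow> (h \<longlongrightarrow> b) F \<Longrightarrow> ((\<lambda>t. poly_xy p (g t) (h t)) \<longlongrightarrow> poly_xy p a b) F"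
  by (induction p) (auto intro!: tendsto_intros)

lemma Phi_tendsto_0:
  assumes "type_I N \<phi> e" shows "(Phi N \<phi> e \<longlongrightarrow> 0) (at_right 0)"
proof -
  have "((\<lambda>t. \<Sum>k=1..N. \<phi> k * t powr e k) \<longlongrightarrow> (\<Sum>k=1..N. \<phi> k * 0)) (at_right 0)"
    using assms unfolding type_I_def
    by (intro tendsto_sum tendsto_mult tendsto_const powr_tendsto_0_at_right) force
  moreover have "\<forall>\<^sub>F t in at_right 0. (\<Sum>k=1..N. \<phi> k * t powr e k) = Phi N \<phi> e t"
    using eventually_unit_interval by eventually_elim (simp add: Phi_def)
  ultimately show ?thesis by (simp add: tendsto_cong)
qed

lemma tendsto_divide_powr_0:
  fixes g :: "real \<Rightarrow> real"
  shows "((\<lambda>t. g t / t powr 0) \<longlongrightarrow> l) (at_right 0) \<longleftrightarrow> (g \<longlongrightarrow> l) (at_right 0)"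
  by (intro tendsto_cong eventually_mono[OF eventually_unit_interval]) simp

lemma leading_power_quotient_limit:
  assumes P: "leading_power P c a" and Q: "leading_power Q d b"
    and l: "((\<lambda>t. P t / Q t) \<longlongrightarrow> l) (at_right 0)"
  shows "l = (if a = b then c / d else 0)"
proof -
  have lim: "((\<lambda>t. (P t / t powr a) / (Q t / t powr b)) \<longlongrightarrow> c / d) (at_right 0)"
    using P Q unfolding leading_power_def by (intro tendsto_divide) auto
  have cd: "c \<noteq> 0" "d \<noteq> 0" using P Q unfolding leading_power_def by auto
  have eq: "\<forall>\<^sub>F t in at_right 0. (P t / t powr a) / (Q t / t powr b) = (P t / Q t) / t powr (a - b)"
    using eventually_unit_interval by eventually_elim (simp add: powr_diff)
  from lim have lim': "((\<lambda>t. (P t / Q t) / t powr (a - b)) \<longlongrightarrow> c / d) (at_right 0)"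
    using eq by (simp add: tendsto_cong)
  have l0: "((\<lambda>t. (P t / Q t) / t powr 0) \<longlongrightarrow> l) (at_right 0)"
    using l by (simp only: tendsto_divide_powr_0)
  consider "a = b" | "0 < a - b" | "a - b < 0" by linarith
  then show ?thesis
  proof cases
    case 1
    then show ?thesis using lim' l0 tendsto_unique[OF trivial_limit_at_right_real] by simp
  next
    case 2
    from tendsto_unique[OF trivial_limit_at_right_real l0 tendsto_0_powr_divide[OF lim' this]] 2
    show ?thesis by simp
  next
    case 3
    from tendsto_unique[OF trivial_limit_at_right_real lim' tendsto_0_powr_divide[OF l0 this]] cd
    show ?thesis by simp
  qed
qed

text \<open>
  One more term of the series changes a polynomial only by $O(t^{e_{N+1}})$, because the
  derivative is bounded near the base point.
\<close>

lemma poly_xy_increment_small: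
  assumes II: "type_II \<phi> e" and m: "m < e (Suc N)"
  shows "((\<lambda>t. (poly_xy R t (Phi (Suc N) \<phi> e t) - poly_xy R t (Phi N \<phi> e t)) / t powr m) \<longlongrightarrow> 0)
    (at_right 0)"
proof -
  define d where "d t = Phi (Suc N) \<phi> e t - Phi N \<phi> e t" for t
  have d: "bounded_by_power d (e (Suc N))"
    unfolding d_def by (rule Phi_diff_bounded_by_power[OF II]) simp
  obtain v where v: "\<And>t. \<bar>v t\<bar> \<le> \<bar>d t\<bar>" and mv: "\<And>t. poly_xy R t (Phi N \<phi> e t + d t)
      - poly_xy R t (Phi N \<phi> e t) = d t * poly_xy (pderiv R) t (Phi N \<phi> e t + v t)"
    using poly_xy_mean_value_curve[of d R "Phi N \<phi> e"] by blast
  have Phi: "(Phi N \<phi> e \<longlongrightarrow> 0) (at_right 0)" for N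
    using II unfolding type_II_def by (blast intro: Phi_tendsto_0)
  have "(d \<longlongrightarrow> 0 - 0) (at_right 0)"
    unfolding d_def by (intro tendsto_diff Phi)
  then have "((\<lambda>t. \<bar>d t\<bar>) \<longlongrightarrow> 0) (at_right 0)" by (simp add: tendsto_rabs_zero_iff)
  then have "(v \<longlongrightarrow> 0) (at_right 0)"
    using v by (intro Lim_null_comparison[of v]) (auto intro: always_eventually)
  then have "((\<lambda>t. poly_xy (pderiv R) t (Phi N \<phi> e t + v t) / t powr 0) \<longlongrightarrow>
      poly_xy (pderiv R) 0 (0 + 0)) (at_right 0)"
    unfolding tendsto_divide_powr_0 by (intro tendsto_poly_xy tendsto_add Phi tendsto_ident_at)
  from bounded_by_power_small[OF d this, of m] m mv[symmetric] show ?thesis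
    by (simp add: d_def)
qed

text \<open>
  If the exponents are bounded, the denominator and a nonzero numerator are stable, and the
  limit is eventually constant. If they tend to infinity, the combination $A P + B Q$ of fixed order \<open>m\<close>
  enters: as $P/Q$ has a finite limit, $A P + B Q$ is at most a constant multiple of $Q$, so \<open>Q\<close> has
  order at most \<open>m\<close> at every stage. Once the next exponent exceeds \<open>m\<close>, adding a term changes \<open>P\<close>
  and \<open>Q\<close> by a quantity negligible against \<open>Q\<close>, and the limit no longer changes.
\<close>

lemma convergent_limits_along_series:
  assumes II: "type_II \<phi> e" and Q: "Q \<noteq> 0"
    and lim: "\<And>N. ((\<lambda>t. poly_xy P t (Phi N \<phi> e t) / poly_xy Q t (Phi N \<phi> e t)) \<longlongrightarrow> l N) (at_right 0)"
    and nz: "\<And>N. \<forall>\<^sub>F t in at_right 0. poly_xy Q t (Phi N \<phi> e t) \<noteq> 0"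
    and bezout: "\<And>N. N \<ge> 1 \<Longrightarrow> \<exists>c. leading_power (\<lambda>t. poly_xy (A * P + B * Q) t (Phi N \<phi> e t)) c m"
  shows "convergent l"
proof -
  have eventually_const: "convergent l" if "\<And>N. N \<ge> N0 \<Longrightarrow> l N = k" for N0 k
    using that by (intro convergentI[of _ k] tendsto_eventually eventually_sequentiallyI[of N0])
  show ?thesis
  proof (cases "filterlim e at_top sequentially")
    case True
    then obtain N0 where N0: "\<And>N. N \<ge> N0 \<Longrightarrow> m < e N"
      unfolding filterlim_at_top_dense eventually_sequentially by blast
    \<comment> \<open>With subscripts \<open>0\<close> and \<open>1\<close> for the stages \<open>N\<close> and \<open>N + 1\<close>:
      $P_1/Q_1 = P_0/Q_0 + (P_1 - P_0)/Q_1 - (P_0/Q_0)\,(Q_1 - Q_0)/Q_1$. The increments are $o(t^m)$, and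
      $t^m/Q_1$ converges because it equals $(A_1 P_1/Q_1 + B_1)\,t^m / (A_1 P_1 + B_1 Q_1)$.\<close>
    have step: "l (Suc N) = l N" if N: "N \<ge> N0" for N
    proof -
      define P0 P1 Q0 Q1 where "P0 t = poly_xy P t (Phi N \<phi> e t)"
        and "P1 t = poly_xy P t (Phi (Suc N) \<phi> e t)"
        and "Q0 t = poly_xy Q t (Phi N \<phi> e t)"
        and "Q1 t = poly_xy Q t (Phi (Suc N) \<phi> e t)" for t
      define A1 B1 where "A1 t = poly_xy A t (Phi (Suc N) \<phi> e t)"
        and "B1 t = poly_xy B t (Phi (Suc N) \<phi> e t)" for t
      have Phi: "(Phi N \<phi> e \<longlongrightarrow> 0) (at_right 0)" for N
        using II unfolding type_II_def by (blast intro: Phi_tendsto_0)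
      obtain c where c: "c \<noteq> 0" "((\<lambda>t. (A1 t * P1 t + B1 t * Q1 t) / t powr m) \<longlongrightarrow> c) (at_right 0)"
        using bezout[of "Suc N"] unfolding leading_power_def A1_def B1_def P1_def Q1_def by auto
      have AB: "(A1 \<longlongrightarrow> poly_xy A 0 0) (at_right 0)" "(B1 \<longlongrightarrow> poly_xy B 0 0) (at_right 0)"
        unfolding A1_def B1_def by (intro tendsto_poly_xy Phi tendsto_ident_at)+
      have lims: "((\<lambda>t. P0 t / Q0 t) \<longlongrightarrow> l N) (at_right 0)" "((\<lambda>t. P1 t / Q1 t) \<longlongrightarrow> l (Suc N)) (at_right 0)"
        unfolding P0_def P1_def Q0_def Q1_def by (rule lim)+
      have nz01: "\<forall>\<^sub>F t in at_right 0. Q0 t \<noteq> 0" "\<forall>\<^sub>F t in at_right 0. Q1 t \<noteq> 0"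
        unfolding Q0_def Q1_def by (rule nz)+
      have "\<forall>\<^sub>F t in at_right 0. (A1 t * P1 t + B1 t * Q1 t) / t powr m \<noteq> 0"
        using tendsto_imp_eventually_ne[OF c(2,1)] .
      then have eq: "\<forall>\<^sub>F t in at_right 0. (A1 t * (P1 t / Q1 t) + B1 t) / ((A1 t * P1 t + B1 t * Q1 t) / t powr m)
          = t powr m / Q1 t"
        using nz01(2)
      proof eventually_elim
        case (elim t)
        have "A1 t * (P1 t / Q1 t) + B1 t = (A1 t * P1 t + B1 t * Q1 t) / Q1 t"
          by (simp only: add_divide_distrib times_divide_eq_right nonzero_mult_div_cancel_right[OF elim(2)])
        moreover have "x / Q1 t / (x / t powr m) = t powr m / Q1 t" if "x / t powr m \<noteq> 0" for x
          using that by simp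
        ultimately show ?case using elim(1) by (simp only:) blast
      qed
      have "((\<lambda>t. (A1 t * (P1 t / Q1 t) + B1 t) / ((A1 t * P1 t + B1 t * Q1 t) / t powr m))
          \<longlongrightarrow> (poly_xy A 0 0 * l (Suc N) + poly_xy B 0 0) / c) (at_right 0)"
        by (intro tendsto_divide tendsto_add tendsto_mult AB lims c)
      from Lim_transform_eventually[OF this eq]
      obtain k where k: "((\<lambda>t. t powr m / Q1 t) \<longlongrightarrow> k) (at_right 0)" by blast
      have small: "((\<lambda>t. (P1 t - P0 t) / t powr m) \<longlongrightarrow> 0) (at_right 0)"
        "((\<lambda>t. (Q1 t - Q0 t) / t powr m) \<longlongrightarrow> 0) (at_right 0)"
        unfolding P0_def P1_def Q0_def Q1_def
        by (intro poly_xy_increment_small II N0; use N in simp)+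
      have "((\<lambda>t. P0 t / Q0 t + (P1 t - P0 t) / t powr m * (t powr m / Q1 t)
          - P0 t / Q0 t * ((Q1 t - Q0 t) / t powr m * (t powr m / Q1 t))) \<longlongrightarrow>
          l N + 0 * k - l N * (0 * k)) (at_right 0)"
        by (intro tendsto_intros lims small k)
      moreover have "\<forall>\<^sub>F t in at_right 0. P0 t / Q0 t + (P1 t - P0 t) / t powr m * (t powr m / Q1 t)
          - P0 t / Q0 t * ((Q1 t - Q0 t) / t powr m * (t powr m / Q1 t)) = P1 t / Q1 t"
        using nz01 eventually_unit_interval
      proof eventually_elim
        case (elim t)
        have cancel: "x / t powr m * (t powr m / Q1 t) = x / Q1 t" for x
          using elim by simp
        have "P0 t / Q0 t * ((Q1 t - Q0 t) / Q1 t) = P0 t / Q0 t - P0 t / Q1 t"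
          using elim by (simp add: diff_divide_distrib right_diff_distrib)
        then show ?case unfolding cancel by (simp add: diff_divide_distrib)
      qed
      ultimately have "((\<lambda>t. P1 t / Q1 t) \<longlongrightarrow> l N) (at_right 0)"
        by (simp add: tendsto_cong)
      then show ?thesis
        using lims(2) tendsto_unique[OF trivial_limit_at_right_real] by blast
    qed
    have "l N = l N0" if "N \<ge> N0" for N
      using that by (induction rule: dec_induct) (simp_all add: step)
    then show ?thesis by (rule eventually_const)
  next
    case False
    show ?thesis
    proof (cases "P = 0")
      case True
      have "l N = 0" for N
        using tendsto_unique[OF trivial_limit_at_right_real lim[of N]] True by simp
      then show ?thesis by (rule eventually_const)
    next
      case Pnz: False
      obtain c w N0 where P: "stable_along \<phi> e P c w N0"
        using stable_along_or_exponents_unbounded[OF II Pnz] False by blast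
      obtain d v N1 where Q: "stable_along \<phi> e Q d v N1"
        using stable_along_or_exponents_unbounded[OF II Q] False by blast
      have "l N = (if w = v then c / d else 0)" if "N \<ge> max N0 N1" for N
        using that by (intro leading_power_quotient_limit[OF _ _ lim]
            stable_along_leading_power[OF P] stable_along_leading_power[OF Q]) auto
      then show ?thesis by (rule eventually_const)
    qed
  qed
qed

section \<open>Coordinates adapted to the four kinds of half-curves\<close>

text \<open>
  Adapted coordinates: \<open>t\<close> is the distance from \<open>z\<close> in the direction of the half-curve and \<open>u\<close>
  the transversal displacement. In these coordinates the four kinds of half-curves become the
  single curve \<open>u = h t\<close> with \<open>t\<close> positive, and polynomials remain polynomials.
\<close>

fun side_point :: "side \<Rightarrow> real \<times> real \<Rightarrow> real \<Rightarrow> real \<Rightarrow> real \<times> real" where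
  "side_point X_right (x0, y0) t u = (x0 + t, y0 + u)"
| "side_point X_left (x0, y0) t u = (x0 - t, y0 + u)"
| "side_point Y_up (x0, y0) t u = (x0 + u, y0 + t)"
| "side_point Y_down (x0, y0) t u = (x0 + u, y0 - t)"

fun side_param :: "side \<Rightarrow> real \<times> real \<Rightarrow> real \<times> real \<Rightarrow> real" where
  "side_param X_right (x0, y0) w = fst w - x0"
| "side_param X_left (x0, y0) w = x0 - fst w"
| "side_param Y_up (x0, y0) w = snd w - y0"
| "side_param Y_down (x0, y0) w = y0 - snd w"

lemma half_curve_side_point:
  assumes even: "\<And>t. h (- t) = h t" and "w \<in> half_curve s h z"
  shows "w = side_point s z (side_param s z w) (h (side_param s z w)) \<and> side_param s z w \<ge> 0"
proof -
  have "h (b - a) = h (a - b)" for a b using even[of "a - b"] by simp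
  then show ?thesis using assms(2) by (cases s; cases z) auto
qed

lemma side_point_0_0: "side_point s z 0 0 = z"
  by (cases s; cases z) auto

lemma side_point_tendsto:
  assumes "(h \<longlongrightarrow> 0) (at_right 0)"
  shows "((\<lambda>t. side_point s z t (h t)) \<longlongrightarrow> z) (at_right 0)"
  by (cases s; cases z) (auto intro!: tendsto_eq_intros assms)

lemma side_point_neq: "t > 0 \<Longrightarrow> side_point s z t u \<noteq> z"
  by (cases s; cases z) auto

lemma side_param_fun:
  "side_param X_right (x0, y0) = (\<lambda>w. fst w - x0)"
  "side_param X_left (x0, y0) = (\<lambda>w. x0 - fst w)"
  "side_param Y_up (x0, y0) = (\<lambda>w. snd w - y0)"
  "side_param Y_down (x0, y0) = (\<lambda>w. y0 - snd w)"
  by auto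

lemma side_param_filterlim:
  assumes even: "\<And>t. h (- t) = h t" and h0: "h 0 = 0"
  shows "filterlim (side_param s z) (at_right 0) (at z within half_curve s h z)"
proof -
  have "(side_param s z \<longlongrightarrow> side_param s z z) (at z within half_curve s h z)"
    by (cases s; cases z) (auto simp: side_param_fun intro!: tendsto_eq_intros)
  moreover have "side_param s z z = 0" by (cases s; cases z) auto
  moreover have "side_param s z w > 0" if "w \<in> half_curve s h z" "w \<noteq> z" for w
    using half_curve_side_point[where h = h, OF even that(1)] that(2) h0 side_point_0_0[of s z]
    by (metis order_le_less)
  then have "\<forall>\<^sub>F w in at z within half_curve s h z. side_param s z w \<in> {0<..} \<and> side_param s z w \<noteq> 0"
    by (fastforce simp: eventually_at intro: exI[of _ 1])
  ultimately show ?thesis by (simp add: filterlim_at)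
qed

text \<open>
  Since the test functions depend only on \<open>\<bar>t\<bar>\<close>, the parametrisation by the distance covers
  the left and lower half-curves too. All limits are therefore computed for $t \to 0^+$.
\<close>

lemma tendsto_half_curve:
  assumes even: "\<And>t. h (- t) = h t" and h0: "h 0 = 0"
    and lim: "((\<lambda>t. f (side_point s z t (h t))) \<longlongrightarrow> l) (at_right 0)"
  shows "(f \<longlongrightarrow> l) (at z within half_curve s h z)"
proof -
  have "((\<lambda>w. f (side_point s z (side_param s z w) (h (side_param s z w)))) \<longlongrightarrow> l)
      (at z within half_curve s h z)"
    by (rule filterlim_compose[OF lim side_param_filterlim[OF even h0]])
  moreover have "\<forall>\<^sub>F w in at z within half_curve s h z.
      f (side_point s z (side_param s z w) (h (side_param s z w))) = f w"
    using half_curve_side_point[where h = h, OF even]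
    by (auto simp: eventually_at intro!: exI[of _ 1])
  ultimately show ?thesis by (rule Lim_transform_eventually)
qed

lemma Phi_even: "Phi N \<phi> e (- t) = Phi N \<phi> e t"
  by (simp add: Phi_def)

lemma test_fun_even: "test_fun h \<Longrightarrow> h (- t) = h t"
  by (induction rule: test_fun.induct) (simp_all add: Phi_even)

lemma test_fun_tendsto_0: "test_fun h \<Longrightarrow> (h \<longlongrightarrow> 0) (at_right 0)"
proof -
  have pos: "a > 0" if "type_I N \<phi> e" "exponent_ok N e a" for N \<phi> e a
  proof (cases "N = 0")
    case False
    then have "1 \<le> e N" using that(1) unfolding type_I_def by auto
    then show ?thesis using that(2) False unfolding exponent_ok_def by simp
  qed (use that in \<open>auto simp: exponent_ok_def\<close>)
  have add: "((\<lambda>t. Phi N \<phi> e t + g t) \<longlongrightarrow> 0) (at_right 0)"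
    if "type_I N \<phi> e" "(log_monom s \<longlongrightarrow> 0) (at_right 0)"
      "\<And>t. t \<in> {0<..<1} \<Longrightarrow> g t = log_monom s t" for N \<phi> e g s
  proof -
    have "(g \<longlongrightarrow> 0) (at_right 0)"
      using that(2) eventually_mono[OF eventually_unit_interval that(3)[symmetric]]
      by (rule Lim_transform_eventually)
    from tendsto_add[OF Phi_tendsto_0[OF that(1)] this] show ?thesis by simp
  qed
  assume "test_fun h"
  then show ?thesis
  proof (induction rule: test_fun.induct)
    case (plain N \<phi> e)
    then show ?case by (rule Phi_tendsto_0)
  next
    case (irrational N \<phi> e a)
    then show ?case using pos
      by (intro add[of _ _ _ "(a, 0)"] log_monom_tendsto_0) (auto simp: log_monom_def)
  next
    case (div_ln N \<phi> e a)
    then show ?case using pos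
      by (intro add[of _ _ _ "(a, -1)"] log_monom_tendsto_0) (auto simp: log_monom_def divide_inverse)
  next
    case (times_ln N \<phi> e a)
    then show ?case using pos
      by (intro add[of _ _ _ "(a, 1)"] log_monom_tendsto_0) (auto simp: log_monom_def)
  qed
qed

lemma poly_xy_subst:
  "\<exists>p'. \<forall>t u. poly_xy p (poly_xy a t u) (poly_xy b t u) = poly_xy p' t u"
proof -
  have inner: "\<exists>r'. \<forall>t u. poly r (poly_xy a t u) = poly_xy r' t u" for r
  proof (induction r)
    case 0
    show ?case by (intro exI[of _ 0]) simp
  next
    case (pCons c r)
    then obtain r' where "\<forall>t u. poly r (poly_xy a t u) = poly_xy r' t u" by blast
    then show ?case by (intro exI[of _ "[:[:c:]:] + a * r'"]) simp
  qed
  show ?thesis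
  proof (induction p)
    case 0
    show ?case by (intro exI[of _ 0]) simp
  next
    case (pCons r p)
    then obtain p' where "\<forall>t u. poly_xy p (poly_xy a t u) (poly_xy b t u) = poly_xy p' t u" by blast
    moreover obtain r' where "\<forall>t u. poly r (poly_xy a t u) = poly_xy r' t u" using inner by blast
    ultimately show ?case by (intro exI[of _ "r' + b * p'"]) simp
  qed
qed

definition poly_at :: "real poly poly \<Rightarrow> real \<times> real \<Rightarrow> real" where
  "poly_at p z = poly_xy p (fst z) (snd z)"

lemma poly_at_side_point: "\<exists>p'. \<forall>t u. poly_at p (side_point s z t u) = poly_xy p' t u"
proof -
  have "\<exists>a b. \<forall>t u. side_point s z t u = (poly_xy a t u, poly_xy b t u)"
  proof (cases z)
    case (Pair x0 y0)
    show ?thesis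
    proof (cases s)
      case X_right
      then show ?thesis using Pair
        by (intro exI[of _ "[:[:x0, 1:]:]"] exI[of _ "[:[:y0:], 1:]"]) simp
    next
      case X_left
      then show ?thesis using Pair
        by (intro exI[of _ "[:[:x0, -1:]:]"] exI[of _ "[:[:y0:], 1:]"]) simp
    next
      case Y_up
      then show ?thesis using Pair
        by (intro exI[of _ "[:[:x0:], 1:]"] exI[of _ "[:[:y0, 1:]:]"]) simp
    next
      case Y_down
      then show ?thesis using Pair
        by (intro exI[of _ "[:[:x0:], 1:]"] exI[of _ "[:[:y0, -1:]:]"]) simp
    qed
  qed
  then show ?thesis unfolding poly_at_def using poly_xy_subst by fastforce
qed

lemma leading_power_poly:
  assumes g: "leading_power g c a" "a > 0" and "r \<noteq> 0"
  shows "\<exists>d. leading_power (\<lambda>t. poly r (g t)) d (real (order 0 r) * a)"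
proof -
  obtain r1 where r1: "r = [:0, 1:] ^ order 0 r * r1" "\<not> [:0, 1:] dvd r1"
    using order_decomp[OF assms(3), of 0] by auto
  then have nz: "poly r1 0 \<noteq> 0" by (simp add: poly_eq_0_iff_dvd)
  have lim: "((\<lambda>t. g t / t powr a) \<longlongrightarrow> c) (at_right 0)" using g unfolding leading_power_def by blast
  have "((\<lambda>t. g t / t powr 0) \<longlongrightarrow> 0) (at_right 0)"
    by (rule tendsto_0_powr_divide[OF lim]) (rule g)
  then have g0: "(g \<longlongrightarrow> 0) (at_right 0)" unfolding tendsto_divide_powr_0 .
  have "((\<lambda>t. (g t / t powr a) ^ order 0 r * poly r1 (g t)) \<longlongrightarrow> c ^ order 0 r * poly r1 0) (at_right 0)"
    by (intro tendsto_intros lim g0)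
  moreover have "\<forall>\<^sub>F t in at_right 0. (g t / t powr a) ^ order 0 r * poly r1 (g t)
      = poly r (g t) / t powr (real (order 0 r) * a)"
    using eventually_unit_interval
  proof eventually_elim
    case (elim t)
    have "poly r (g t) = g t ^ order 0 r * poly r1 (g t)" by (subst r1(1)) simp
    moreover have "t powr (real (order 0 r) * a) = (t powr a) ^ order 0 r"
      using elim by (simp add: powr_powr powr_realpow[symmetric] mult.commute)
    ultimately show ?case by (simp add: power_divide)
  qed
  ultimately have "((\<lambda>t. poly r (g t) / t powr (real (order 0 r) * a)) \<longlongrightarrow> c ^ order 0 r * poly r1 0) (at_right 0)"
    by (rule Lim_transform_eventually)
  moreover have "c ^ order 0 r * poly r1 0 \<noteq> 0" using g nz unfolding leading_power_def by simp
  ultimately show ?thesis unfolding leading_power_def by blast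
qed

section \<open>Elimination and common zeros of bivariate polynomials\<close>

text \<open>
  Gauss's lemma, in the form in which a polynomial multiplier from the coefficient ring can be
  cancelled.
\<close>

lemma primitive_dvd_smult_imp_dvd:
  fixes d g :: "'a :: {semiring_gcd_mult_normalize, factorial_ring_gcd} poly"
  assumes "content d = 1" "d dvd smult c g" "c \<noteq> 0" shows "d dvd g"
proof -
  have "fract_poly d dvd smult (to_fract c) (fract_poly g)"
    using fract_poly_dvd[OF assms(2)] by simp
  then have "fract_poly d dvd fract_poly g"
    using assms(3) by (simp add: dvd_smult_iff)
  then show ?thesis using assms(1) by (rule fract_poly_dvdD)
qed

text \<open>
  Elimination of the second variable. A nonzero element \<open>d\<close> of least degree in the ideal of \<open>p\<close>
  and \<open>q\<close> divides multiples of \<open>p\<close> and \<open>q\<close> by elements of $\mathbb{R}[x]$, by pseudo-division. Its primitive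
  part therefore divides \<open>p\<close> and \<open>q\<close> themselves and is a unit, so \<open>d\<close> involves only $x$.
\<close>

lemma coprime_elimination:
  fixes p q :: "real poly poly"
  assumes "coprime p q" "q \<noteq> 0"
  shows "\<exists>A B r. r \<noteq> 0 \<and> A * p + B * q = [:r:]"
proof -
  define I where "I = {A * p + B * q | A B. True}"
  have pq: "p \<in> I" "q \<in> I"
  proof -
    have "p = 1 * p + 0 * q" "q = 0 * p + 1 * q" by simp_all
    then show "p \<in> I" "q \<in> I" unfolding I_def by blast+
  qed
  have I: "smult c g - d * k \<in> I" if gd: "g \<in> I" "d \<in> I" for c g d k
  proof -
    obtain A B C D where "g = A * p + B * q" "d = C * p + D * q" using gd unfolding I_def by blast
    then have "smult c g - d * k = (smult c A - C * k) * p + (smult c B - D * k) * q"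
      by (simp add: algebra_simps smult_add_right)
    then show ?thesis unfolding I_def by blast
  qed
  obtain d where d: "d \<in> I" "d \<noteq> 0" and min: "\<And>r. r \<in> I \<Longrightarrow> r \<noteq> 0 \<Longrightarrow> degree d \<le> degree r"
    using ex_has_least_nat[of "\<lambda>r. r \<in> I \<and> r \<noteq> 0" q degree] pq assms(2) by blast
  have dvd: "primitive_part d dvd g" if "g \<in> I" for g
  proof -
    obtain k r where kr: "pseudo_divmod g d = (k, r)" by fastforce
    define c where "c = lead_coeff d ^ (Suc (degree g) - degree d)"
    have r: "smult c g = d * k + r" "r = 0 \<or> degree r < degree d"
      using pseudo_divmod[OF d(2) kr] by (simp_all add: c_def)
    have "smult c g - d * k \<in> I" by (rule I[OF that d(1)])
    then have "r \<in> I" using r(1) by simp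
    then have "r = 0" using r(2) min by force
    then have "d dvd smult c g" using r(1) by simp
    moreover have "primitive_part d dvd d"
      by (metis content_times_primitive_part dvd_smult dvd_refl)
    ultimately have "primitive_part d dvd smult c g" by (rule dvd_trans[rotated])
    then show ?thesis
      by (rule primitive_dvd_smult_imp_dvd[rotated]) (use d in \<open>simp_all add: c_def\<close>)
  qed
  have "is_unit (primitive_part d)"
    using assms(1) dvd[OF pq(1)] dvd[OF pq(2)] by (rule coprime_common_divisor)
  then have "degree d = 0"
    by (metis degree_primitive_part is_unit_iff_degree is_unit_poly_iff degree_pCons_0)
  then obtain r where "d = [:r:]"
    by (rule degree_eq_zeroE)
  moreover obtain A B where "d = A * p + B * q" using d(1) unfolding I_def by blast
  ultimately have "r \<noteq> 0 \<and> A * p + B * q = [:r:]" using d(2) by auto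
  then show ?thesis by blast
qed

lemma poly_xy_map_poly: "poly_xy p x y = poly (map_poly (\<lambda>c. poly c x) p) y"
  by (induction p) (simp_all add: map_poly_pCons)

text \<open>
  Elimination leaves finitely many abscissas. On a vertical line with infinitely many common
  zeros both polynomials would vanish, hence would be divisible by its equation.
\<close>

lemma finite_common_zeros:
  assumes "coprime p q" "q \<noteq> 0"
  shows "finite {z. poly_at p z = 0 \<and> poly_at q z = 0}"
proof -
  obtain A B r where r: "r \<noteq> 0" "A * p + B * q = [:r:]"
    using coprime_elimination[OF assms] by blast
  define Y where "Y x = {y. poly_xy p x y = 0 \<and> poly_xy q x y = 0}" for x
  have "finite (Y x)" for x
  proof (rule ccontr)
    assume inf: "infinite (Y x)"
    have "[:[:-x, 1:]:] dvd g" if "Y x \<subseteq> {y. poly_xy g x y = 0}" for g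
    proof -
      have "infinite {y. poly (map_poly (\<lambda>c. poly c x) g) y = 0}"
        using inf that finite_subset unfolding poly_xy_map_poly by blast
      then have "map_poly (\<lambda>c. poly c x) g = 0" using poly_roots_finite by blast
      then have "poly (coeff g n) x = 0" for n
        by (metis coeff_0 coeff_map_poly poly_0)
      then show ?thesis by (simp add: const_poly_dvd_iff poly_eq_0_iff_dvd)
    qed
    then have "[:[:-x, 1:]:] dvd p" "[:[:-x, 1:]:] dvd q" by (auto simp: Y_def)
    then have "is_unit [:[:-x, 1:]:]" using assms(1) by (metis coprime_common_divisor)
    then show False by (simp add: is_unit_const_poly_iff is_unit_pCons_iff)
  qed
  moreover have "{z. poly_at p z = 0 \<and> poly_at q z = 0} \<subseteq> Sigma {x. poly r x = 0} Y"
  proof clarify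
    fix x y assume z: "poly_at p (x, y) = 0" "poly_at q (x, y) = 0"
    have "poly r x = poly_xy (A * p + B * q) x y" by (simp only: r(2)) simp
    also have "\<dots> = 0" using z by (simp add: poly_at_def)
    finally show "x \<in> {x. poly r x = 0} \<and> y \<in> Y x" using z by (simp add: poly_at_def Y_def)
  qed
  ultimately show ?thesis
    using poly_roots_finite[OF r(1)] finite_SigmaI finite_subset by metis
qed

lemma eventually_at_notin_finite:
  fixes a :: "'a :: t1_space"
  assumes "finite S" shows "\<forall>\<^sub>F x in at a. x \<notin> S"
proof -
  have "open (- (S - {a}))" using assms by (intro open_Compl finite_imp_closed) simp
  then show ?thesis
    unfolding eventually_at_topological by (intro exI[of _ "- (S - {a})"]) auto
qed

text \<open>
  On all vertical lines but finitely many, the denominator is a nonzero polynomial in $y$; so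
  iterated limits of quotients never see the value assigned to division by zero.
\<close>

lemma eventually_poly_xy_nonzero:
  assumes "q \<noteq> 0"
  shows "\<forall>\<^sub>F x in at x0. \<forall>\<^sub>F y in at y0. poly_xy q x y \<noteq> 0"
proof -
  have "\<forall>\<^sub>F x in at x0. x \<notin> {x. poly (lead_coeff q) x = 0}"
    using assms by (intro eventually_at_notin_finite poly_roots_finite) simp
  then show ?thesis
  proof eventually_elim
    case (elim x)
    then have "map_poly (\<lambda>c. poly c x) q \<noteq> 0"
      by (metis (mono_tags, lifting) coeff_0 coeff_map_poly mem_Collect_eq poly_0)
    then have "\<forall>\<^sub>F y in at y0. y \<notin> {y. poly (map_poly (\<lambda>c. poly c x) q) y = 0}"
      by (intro eventually_at_notin_finite poly_roots_finite)
    then show ?case by (simp add: poly_xy_map_poly)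
  qed
qed

lemma open_meets_poly_at_nonzero:
  assumes "q \<noteq> 0" "open U" "z \<in> U"
  shows "\<exists>w\<in>U. poly_at q w \<noteq> 0"
proof -
  obtain A B where AB: "open A" "open B" "z \<in> A \<times> B" "A \<times> B \<subseteq> U"
    using open_prod_elim[OF assms(2,3)] by metis
  have "\<forall>\<^sub>F x in at (fst z). x \<in> A"
    using AB by (intro eventually_at_in_open') auto
  with eventually_poly_xy_nonzero[OF assms(1), of "snd z" "fst z"]
  obtain x where x: "x \<in> A" "\<forall>\<^sub>F y in at (snd z). poly_xy q x y \<noteq> 0"
    using eventually_happens[OF eventually_conj] trivial_limit_at by blast
  have "\<forall>\<^sub>F y in at (snd z). y \<in> B"
    using AB by (intro eventually_at_in_open') auto
  with x(2) obtain y where "y \<in> B" "poly_xy q x y \<noteq> 0"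
    using eventually_happens[OF eventually_conj] trivial_limit_at by blast
  then show ?thesis using x AB by (intro bexI[of _ "(x, y)"]) (auto simp: poly_at_def)
qed

lemma isCont_poly_at: "isCont (poly_at p) z"
  unfolding isCont_def poly_at_def by (intro tendsto_poly_xy tendsto_fst tendsto_snd tendsto_ident_at)

lemma continuous_on_poly_at: "continuous_on S (poly_at p)"
  by (simp add: continuous_at_imp_continuous_on isCont_poly_at)

section \<open>Rational functions near an interior point\<close>

text \<open>
  Inside \<open>G\<close> there are no poles: on the dense set where $q \neq 0$ boundedness says
  $|p| \le C |q|$, and by continuity every zero of $q$ in \<open>G\<close> is a zero of $p$. Coprime polynomials
  have finitely many common zeros.
\<close>

lemma rat_fun_representation:
  assumes "open G" "f \<in> rat_fun G"
  obtains p q where "coprime p q" "q \<noteq> 0" "finite {z. poly_at p z = 0 \<and> poly_at q z = 0}"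
    "\<And>z. z \<in> G \<Longrightarrow> \<not> (poly_at p z = 0 \<and> poly_at q z = 0) \<Longrightarrow>
       poly_at q z \<noteq> 0 \<and> f z = poly_at p z / poly_at q z"
proof -
  obtain p q where pq: "coprime p q" "q \<noteq> 0" and val: "\<And>z. z \<in> closure G \<Longrightarrow> rat_value p q z (f z)"
    using assms(2) unfolding rat_fun_def by blast
  obtain C where C: "\<And>z. z \<in> G \<Longrightarrow> \<bar>f z\<bar> \<le> C"
    using assms(2) unfolding rat_fun_def bounded_iff by auto
  have f: "f z = poly_at p z / poly_at q z" if "z \<in> G" "poly_at q z \<noteq> 0" for z
    using val[of z] that closure_subset[of G] by (auto simp: rat_value_def poly_at_def)
  have pole: "poly_at p z = 0" if z: "z \<in> G" "poly_at q z = 0" for z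
  proof -
    have "z \<in> closure {w \<in> G. poly_at q w \<noteq> 0}"
      unfolding closure_iff_nhds_not_empty
    proof (intro allI impI)
      fix A V assume "V \<subseteq> A" "open V" "z \<in> V"
      then have "open (V \<inter> G)" "z \<in> V \<inter> G" using assms(1) z by auto
      from open_meets_poly_at_nonzero[OF pq(2) this] \<open>V \<subseteq> A\<close>
      show "{w \<in> G. poly_at q w \<noteq> 0} \<inter> A \<noteq> {}" by blast
    qed
    moreover have "closure {w \<in> G. poly_at q w \<noteq> 0} \<subseteq> {w. \<bar>poly_at p w\<bar> \<le> C * \<bar>poly_at q w\<bar>}"
    proof (rule closure_minimal)
      show "{w \<in> G. poly_at q w \<noteq> 0} \<subseteq> {w. \<bar>poly_at p w\<bar> \<le> C * \<bar>poly_at q w\<bar>}"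
      proof clarify
        fix x y assume w: "(x, y) \<in> G" "poly_at q (x, y) \<noteq> 0"
        then have "poly_at p (x, y) = f (x, y) * poly_at q (x, y)" using f by simp
        then show "\<bar>poly_at p (x, y)\<bar> \<le> C * \<bar>poly_at q (x, y)\<bar>"
          using C[OF w(1)] by (simp add: abs_mult mult_right_mono)
      qed
      show "closed {w. \<bar>poly_at p w\<bar> \<le> C * \<bar>poly_at q w\<bar>}"
        by (intro closed_Collect_le continuous_intros continuous_on_poly_at)
    qed
    ultimately show ?thesis using z(2) by auto
  qed
  show thesis
    by (rule that[OF pq finite_common_zeros[OF pq]]) (use pole f in blast)+
qed

lemma rat_fun_finitely_many_discontinuities:
  assumes G: "open G" and f: "f \<in> rat_fun G"
  shows "finite {z \<in> closure G. \<not> continuous (at z within closure G) f}"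
proof -
  obtain p q where Z: "finite {z. poly_at p z = 0 \<and> poly_at q z = 0}" (is "finite ?Z")
    and pq: "\<And>z. z \<in> G \<Longrightarrow> \<not> (poly_at p z = 0 \<and> poly_at q z = 0) \<Longrightarrow>
       poly_at q z \<noteq> 0 \<and> f z = poly_at p z / poly_at q z"
    using rat_fun_representation[OF G f, of thesis] by blast
  have "continuous (at z within closure G) f" if z: "z \<in> closure G" "z \<notin> ?Z" for z
  proof (cases "z \<in> G")
    case True
    have op: "open (G - ?Z)" using G Z by (intro open_Diff finite_imp_closed)
    have zz: "z \<in> G - ?Z" using True z by blast
    have "isCont (\<lambda>w. poly_at p w / poly_at q w) z"
      using pq[OF True] z(2) by (intro continuous_intros isCont_poly_at) auto
    moreover have "\<forall>\<^sub>F w in nhds z. poly_at p w / poly_at q w = f w"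
      using eventually_nhds_in_open[OF op zz] by eventually_elim (use pq in auto)
    ultimately have "isCont f z" by (simp add: isCont_cong)
    then show ?thesis by (rule continuous_at_imp_continuous_at_within)
  next
    case False
    then have "z \<in> frontier G" using z G by (simp add: frontier_def interior_open)
    then show ?thesis using f unfolding rat_fun_def by blast
  qed
  then have "{z \<in> closure G. \<not> continuous (at z within closure G) f} \<subseteq> ?Z" by blast
  then show ?thesis using Z finite_subset by blast
qed

text \<open>
  In adapted coordinates, a rational function along any curve through \<open>z\<close> is a quotient of
  polynomials with nonvanishing denominator close to \<open>z\<close>. A combination of the two that depends on
  the first coordinate of the plane alone is kept for the argument about series.
\<close>

lemma rat_fun_along_curve:
  assumes G: "open G" and f: "f \<in> rat_fun G" and z: "z \<in> G"
  obtains P Q A B r where "Q \<noteq> 0" "r \<noteq> 0"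
    "\<And>t u. poly_xy (A * P + B * Q) t u = poly r (fst (side_point s z t u))"
    "\<And>h. (h \<longlongrightarrow> 0) (at_right 0) \<Longrightarrow> \<forall>\<^sub>F t in at_right 0. poly_xy Q t (h t) \<noteq> 0 \<and>
       f (side_point s z t (h t)) = poly_xy P t (h t) / poly_xy Q t (h t)"
proof -
  obtain p q where pq: "coprime p q" "q \<noteq> 0"
    and Z: "finite {z. poly_at p z = 0 \<and> poly_at q z = 0}" (is "finite ?Z")
    and val: "\<And>z. z \<in> G \<Longrightarrow> \<not> (poly_at p z = 0 \<and> poly_at q z = 0) \<Longrightarrow>
       poly_at q z \<noteq> 0 \<and> f z = poly_at p z / poly_at q z"
    using rat_fun_representation[OF G f, of thesis] by blast
  obtain a b r where r: "r \<noteq> 0" "a * p + b * q = [:r:]"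
    using coprime_elimination[OF pq] by blast
  obtain P where P: "\<And>t u. poly_at p (side_point s z t u) = poly_xy P t u"
    using poly_at_side_point by blast
  obtain Q where Q: "\<And>t u. poly_at q (side_point s z t u) = poly_xy Q t u"
    using poly_at_side_point by blast
  obtain A where A: "\<And>t u. poly_at a (side_point s z t u) = poly_xy A t u"
    using poly_at_side_point by blast
  obtain B where B: "\<And>t u. poly_at b (side_point s z t u) = poly_xy B t u"
    using poly_at_side_point by blast
  have curve: "\<forall>\<^sub>F t in at_right 0. poly_xy Q t (h t) \<noteq> 0 \<and>
       f (side_point s z t (h t)) = poly_xy P t (h t) / poly_xy Q t (h t)"
    if h: "(h \<longlongrightarrow> 0) (at_right 0)" for h
  proof -
    \<comment> \<open>The centre may itself be a common zero, but the curve does not return to it.\<close>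
    have "open (G - (?Z - {z}))" using G Z by (intro open_Diff finite_imp_closed) auto
    moreover have "z \<in> G - (?Z - {z})" using z by blast
    ultimately have "\<forall>\<^sub>F t in at_right 0. side_point s z t (h t) \<in> G - (?Z - {z})"
      using side_point_tendsto[OF h] by (rule topological_tendstoD[rotated])
    then show ?thesis using eventually_unit_interval
    proof eventually_elim
      case (elim t)
      then have "side_point s z t (h t) \<in> G" "side_point s z t (h t) \<notin> ?Z"
        using side_point_neq[of t s z "h t"] by auto
      then show ?case using val[of "side_point s z t (h t)"] by (simp add: P Q)
    qed
  qed
  have "Q \<noteq> 0"
  proof
    assume "Q = 0"
    then show False
      using eventually_happens[OF curve[OF tendsto_const]] by simp
  qed
  moreover have "poly_xy (A * P + B * Q) t u = poly r (fst (side_point s z t u))" for t u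
  proof -
    have "poly_xy (A * P + B * Q) t u = poly_at (a * p + b * q) (side_point s z t u)"
      by (simp add: poly_at_def P[symmetric] Q[symmetric] A[symmetric] B[symmetric])
    also have "\<dots> = poly r (fst (side_point s z t u))" by (simp add: r poly_at_def)
    finally show ?thesis .
  qed
  ultimately show thesis using that r(1) curve by blast
qed

lemma rat_fun_limit_along_curve:
  assumes G: "open G" and f: "f \<in> rat_fun G" and z: "z \<in> G"
    and h: "h \<in> log_sums UNIV" "(h \<longlongrightarrow> 0) (at_right 0)"
  shows "\<exists>l. ((\<lambda>t. f (side_point s z t (h t))) \<longlongrightarrow> l) (at_right 0)"
proof -
  obtain C where C: "\<And>z. z \<in> G \<Longrightarrow> \<bar>f z\<bar> \<le> C"
    using f unfolding rat_fun_def bounded_iff by auto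
  obtain P Q where PQ: "\<forall>\<^sub>F t in at_right 0. poly_xy Q t (h t) \<noteq> 0 \<and>
       f (side_point s z t (h t)) = poly_xy P t (h t) / poly_xy Q t (h t)"
    using rat_fun_along_curve[OF G f z, of s thesis] h(2) by blast
  have inG: "\<forall>\<^sub>F t in at_right 0. side_point s z t (h t) \<in> G"
    using side_point_tendsto[OF h(2)] G z by (rule topological_tendstoD)
  have poly: "(\<lambda>t. poly_xy R t (h t)) \<in> log_sums UNIV" for R
    by (intro log_sums_poly_xy log_sums_ident h) auto
  have "\<exists>l. ((\<lambda>t. poly_xy P t (h t) / poly_xy Q t (h t)) \<longlongrightarrow> l) (at_right 0)"
  proof (rule bounded_log_sum_quotient_convergent[OF poly poly])
    show "\<forall>\<^sub>F t in at_right 0. poly_xy Q t (h t) \<noteq> 0" using PQ by eventually_elim simp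
    show "\<forall>\<^sub>F t in at_right 0. \<bar>poly_xy P t (h t) / poly_xy Q t (h t)\<bar> \<le> C"
      using PQ inG by eventually_elim (metis C)
  qed
  then obtain l where l: "((\<lambda>t. poly_xy P t (h t) / poly_xy Q t (h t)) \<longlongrightarrow> l) (at_right 0)" by blast
  have "((\<lambda>t. f (side_point s z t (h t))) \<longlongrightarrow> l) (at_right 0)"
    by (rule Lim_transform_eventually[OF l]) (rule eventually_mono[OF PQ], simp)
  then show ?thesis by blast
qed

lemma leading_power_Phi:
  assumes II: "type_II \<phi> e" and "N \<ge> 1"
  shows "leading_power (Phi N \<phi> e) (\<phi> 1) (e 1)"
proof -
  have "((\<lambda>t. Phi N \<phi> e t / t powr e 1) \<longlongrightarrow> \<phi> 1) (at_right 0)"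
    using assms(2)
  proof (induction rule: dec_induct)
    case base
    show ?case
      by (intro tendsto_eventually eventually_mono[OF eventually_unit_interval]) (simp add: Phi_def)
  next
    case (step N)
    have "e (Suc N) - e 1 > 0" using type_II_strict_mono[OF II, of 1 "Suc N"] step by simp
    from tendsto_add[OF step(3) tendsto_mult[OF tendsto_const powr_tendsto_0_at_right[OF this], of "\<phi> (Suc N)"]]
    have "((\<lambda>t. Phi N \<phi> e t / t powr e 1 + \<phi> (Suc N) * t powr (e (Suc N) - e 1)) \<longlongrightarrow> \<phi> 1) (at_right 0)"
      by simp
    moreover have "\<forall>\<^sub>F t in at_right 0. Phi N \<phi> e t / t powr e 1 + \<phi> (Suc N) * t powr (e (Suc N) - e 1)
        = Phi (Suc N) \<phi> e t / t powr e 1"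
      using eventually_unit_interval
      by eventually_elim (simp add: Phi_Suc powr_diff add_divide_distrib)
    ultimately show ?case by (rule Lim_transform_eventually)
  qed
  then show ?thesis using type_II_D[OF II, of 1] unfolding leading_power_def by simp
qed

text \<open>
  The eliminated polynomial \<open>r\<close> depends on the first coordinate of the plane. Along the
  curves this coordinate differs from that of \<open>z\<close> by $\pm t$ for horizontal half-curves and by
  $\Phi_N(t) \sim \phi_1 t^{e_1}$ for vertical ones. In either case the order of \<open>r\<close> is independent of
  $N \ge 1$.
\<close>

lemma leading_power_coordinate:
  assumes II: "type_II \<phi> e" and r: "r \<noteq> 0"
  obtains m where "\<And>N. N \<ge> 1 \<Longrightarrow>
    \<exists>c. leading_power (\<lambda>t. poly r (fst (side_point s z t (Phi N \<phi> e t)))) c m"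
proof -
  note exponent = that
  have id: "leading_power (\<lambda>t. t) 1 1"
    unfolding leading_power_def
    by (auto intro!: tendsto_eventually eventually_mono[OF eventually_unit_interval])
  have shift: "r \<circ>\<^sub>p [:fst z, k:] \<noteq> 0" if "k \<noteq> 0" for k
    using that r by (simp add: pcompose_eq_0_iff)
  have horizontal: thesis if k: "k \<noteq> 0" "\<And>t u. fst (side_point s z t u) = fst z + k * t" for k
  proof -
    have "\<exists>d. leading_power (\<lambda>t. poly (r \<circ>\<^sub>p [:fst z, k:]) t) d
        (real (order 0 (r \<circ>\<^sub>p [:fst z, k:])) * 1)"
      by (rule leading_power_poly[OF id _ shift[OF k(1)]]) simp
    then show thesis by (intro exponent) (simp add: k(2) poly_pcompose mult.commute)
  qed
  have vertical: thesis if k: "\<And>t u. fst (side_point s z t u) = fst z + u"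
  proof -
    have "\<exists>d. leading_power (\<lambda>t. poly (r \<circ>\<^sub>p [:fst z, 1:]) (Phi N \<phi> e t)) d
        (real (order 0 (r \<circ>\<^sub>p [:fst z, 1:])) * e 1)" if "N \<ge> 1" for N
      using type_II_D(3)[OF II, of 1]
      by (intro leading_power_poly[OF leading_power_Phi[OF II that]] shift) auto
    then show thesis by (intro exponent) (simp add: k poly_pcompose)
  qed
  show thesis
  proof (cases s)
    case X_right
    then show thesis by (cases z) (auto intro!: horizontal[of 1])
  next
    case X_left
    then show thesis by (cases z) (auto intro!: horizontal[of "-1"])
  qed (cases z; auto intro!: vertical)+
qed

lemma rat_fun_limits_along_series_converge:
  assumes G: "open G" and f: "f \<in> rat_fun G" and z: "z \<in> G" and II: "type_II \<phi> e"
    and lim: "\<And>N. ((\<lambda>t. f (side_point s z t (Phi N \<phi> e t))) \<longlongrightarrow> l N) (at_right 0)"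
  shows "convergent l"
proof -
  obtain P Q A B r where Q: "Q \<noteq> 0" and r: "r \<noteq> 0"
    and AB: "\<And>t u. poly_xy (A * P + B * Q) t u = poly r (fst (side_point s z t u))"
    and curve: "\<And>h. (h \<longlongrightarrow> 0) (at_right 0) \<Longrightarrow> \<forall>\<^sub>F t in at_right 0. poly_xy Q t (h t) \<noteq> 0 \<and>
       f (side_point s z t (h t)) = poly_xy P t (h t) / poly_xy Q t (h t)"
    by (rule rat_fun_along_curve[OF G f z, of s]) (rule that)
  have Phi: "(Phi N \<phi> e \<longlongrightarrow> 0) (at_right 0)" for N
    using II unfolding type_II_def by (blast intro: Phi_tendsto_0)
  obtain m where m: "\<And>N. N \<ge> 1 \<Longrightarrow>
      \<exists>c. leading_power (\<lambda>t. poly_xy (A * P + B * Q) t (Phi N \<phi> e t)) c m"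
    unfolding AB using leading_power_coordinate[OF II r, of s z thesis] by blast
  show ?thesis
  proof (rule convergent_limits_along_series[OF II Q _ _ m])
    show "((\<lambda>t. poly_xy P t (Phi N \<phi> e t) / poly_xy Q t (Phi N \<phi> e t)) \<longlongrightarrow> l N) (at_right 0)" for N
      by (rule Lim_transform_eventually[OF lim])
        (rule eventually_mono[OF curve[OF Phi, of N]], simp)
    show "\<forall>\<^sub>F t in at_right 0. poly_xy Q t (Phi N \<phi> e t) \<noteq> 0" for N
      using curve[OF Phi, of N] by eventually_elim simp
  qed
qed

section \<open>The algebra of rational functions and its closure\<close>

lemma has_iterated_limitI:
  "\<forall>\<^sub>F x in at x0. (F x \<longlongrightarrow> g x) (at y0) \<Longrightarrow> (g \<longlongrightarrow> l) (at x0) \<Longrightarrow> has_iterated_limit F x0 y0 l"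
  unfolding has_iterated_limit_def by blast

lemma iterated_limit_unique:
  assumes "has_iterated_limit F x0 y0 l" "has_iterated_limit F x0 y0 m" shows "l = m"
proof -
  obtain g where g: "\<forall>\<^sub>F x in at x0. (F x \<longlongrightarrow> g x) (at y0)" "(g \<longlongrightarrow> l) (at x0)"
    using assms(1) unfolding has_iterated_limit_def by blast
  obtain h where h: "\<forall>\<^sub>F x in at x0. (F x \<longlongrightarrow> h x) (at y0)" "(h \<longlongrightarrow> m) (at x0)"
    using assms(2) unfolding has_iterated_limit_def by blast
  have "\<forall>\<^sub>F x in at x0. g x = h x"
    using g(1) h(1) by eventually_elim (rule tendsto_unique[OF at_neq_bot])
  then have "(h \<longlongrightarrow> l) (at x0)" using g(2) by (rule Lim_transform_eventually[rotated])
  then show ?thesis using h(2) by (rule tendsto_unique[OF at_neq_bot])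
qed

lemma iterated_limit_cong:
  assumes "\<forall>\<^sub>F x in at x0. \<forall>\<^sub>F y in at y0. F x y = H x y" "has_iterated_limit F x0 y0 l"
  shows "has_iterated_limit H x0 y0 l"
proof -
  obtain g where g: "\<forall>\<^sub>F x in at x0. (F x \<longlongrightarrow> g x) (at y0)" "(g \<longlongrightarrow> l) (at x0)"
    using assms(2) unfolding has_iterated_limit_def by blast
  have "\<forall>\<^sub>F x in at x0. (H x \<longlongrightarrow> g x) (at y0)"
    using g(1) assms(1) by eventually_elim (rule Lim_transform_eventually)
  then show ?thesis using g(2) by (rule has_iterated_limitI)
qed

lemma iterated_limit_add:
  assumes "has_iterated_limit F x0 y0 l" "has_iterated_limit H x0 y0 m"
  shows "has_iterated_limit (\<lambda>x y. F x y + H x y) x0 y0 (l + m)"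
proof -
  obtain g where g: "\<forall>\<^sub>F x in at x0. (F x \<longlongrightarrow> g x) (at y0)" "(g \<longlongrightarrow> l) (at x0)"
    using assms(1) unfolding has_iterated_limit_def by blast
  obtain h where h: "\<forall>\<^sub>F x in at x0. (H x \<longlongrightarrow> h x) (at y0)" "(h \<longlongrightarrow> m) (at x0)"
    using assms(2) unfolding has_iterated_limit_def by blast
  have "\<forall>\<^sub>F x in at x0. ((\<lambda>y. F x y + H x y) \<longlongrightarrow> g x + h x) (at y0)"
    using g(1) h(1) by eventually_elim (rule tendsto_add)
  then show ?thesis using tendsto_add[OF g(2) h(2)] by (rule has_iterated_limitI)
qed

lemma iterated_limit_mult:
  assumes "has_iterated_limit F x0 y0 l" "has_iterated_limit H x0 y0 m"
  shows "has_iterated_limit (\<lambda>x y. F x y * H x y) x0 y0 (l * m)"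
proof -
  obtain g where g: "\<forall>\<^sub>F x in at x0. (F x \<longlongrightarrow> g x) (at y0)" "(g \<longlongrightarrow> l) (at x0)"
    using assms(1) unfolding has_iterated_limit_def by blast
  obtain h where h: "\<forall>\<^sub>F x in at x0. (H x \<longlongrightarrow> h x) (at y0)" "(h \<longlongrightarrow> m) (at x0)"
    using assms(2) unfolding has_iterated_limit_def by blast
  have "\<forall>\<^sub>F x in at x0. ((\<lambda>y. F x y * H x y) \<longlongrightarrow> g x * h x) (at y0)"
    using g(1) h(1) by eventually_elim (rule tendsto_mult)
  then show ?thesis using tendsto_mult[OF g(2) h(2)] by (rule has_iterated_limitI)
qed

text \<open>
  At points where the denominator does not vanish, the value is also the iterated limit. This
  uniform description makes the values compatible with sums, products and cancellation.
\<close>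

lemma rat_value_iff_iterated_limit:
  "rat_value p q z v \<longleftrightarrow>
    has_iterated_limit (\<lambda>x y. poly_xy p x y / poly_xy q x y) (fst z) (snd z) v"
proof (cases "poly_xy q (fst z) (snd z) = 0")
  case True
  then show ?thesis by (simp add: rat_value_def)
next
  case False
  have "\<forall>\<^sub>F x in at (fst z). poly_xy q x (snd z) \<noteq> 0"
    by (rule tendsto_imp_eventually_ne[OF tendsto_poly_xy[OF tendsto_ident_at tendsto_const] False])
  then have "\<forall>\<^sub>F x in at (fst z). ((\<lambda>y. poly_xy p x y / poly_xy q x y) \<longlongrightarrow>
      poly_xy p x (snd z) / poly_xy q x (snd z)) (at (snd z))"
    by eventually_elim (intro tendsto_divide tendsto_poly_xy tendsto_const tendsto_ident_at)
  moreover have "((\<lambda>x. poly_xy p x (snd z) / poly_xy q x (snd z)) \<longlongrightarrow>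
      poly_xy p (fst z) (snd z) / poly_xy q (fst z) (snd z)) (at (fst z))"
    using False by (intro tendsto_divide tendsto_poly_xy tendsto_const tendsto_ident_at)
  ultimately have "has_iterated_limit (\<lambda>x y. poly_xy p x y / poly_xy q x y) (fst z) (snd z)
      (poly_xy p (fst z) (snd z) / poly_xy q (fst z) (snd z))"
    by (rule has_iterated_limitI)
  then show ?thesis using False iterated_limit_unique unfolding rat_value_def by auto
qed

lemma continuous_within_restrict:
  fixes f :: "'a :: t2_space \<Rightarrow> 'b :: topological_space"
  assumes "z \<in> S"
  shows "continuous (at z within S) (restrict f S) \<longleftrightarrow> continuous (at z within S) f"
proof -
  have "\<forall>\<^sub>F x in at z within S. restrict f S x = f x"
    by (simp add: eventually_at_filter)
  then show ?thesis
    using assms unfolding continuous_within by (subst tendsto_cong) auto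
qed

text \<open>
  A fraction need not be given in lowest terms: cancelling the greatest common divisor does
  not affect iterated limits.
\<close>

lemma rat_funI:
  assumes Q: "Q \<noteq> 0"
    and val: "\<And>z. z \<in> closure G \<Longrightarrow>
      has_iterated_limit (\<lambda>x y. poly_xy P x y / poly_xy Q x y) (fst z) (snd z) (h z)"
    and bdd: "bounded (h ` G)"
    and cont: "\<And>z. z \<in> frontier G \<Longrightarrow> continuous (at z within closure G) h"
  shows "restrict h (closure G) \<in> rat_fun G"
proof -
  define d where "d = gcd P Q"
  have d: "d \<noteq> 0" using Q by (simp add: d_def)
  then obtain p q where pq: "P = p * d" "Q = q * d" "coprime p q"
    using gcd_coprime_exists[of P Q] unfolding d_def by blast
  have "rat_value p q z (restrict h (closure G) z)" if "z \<in> closure G" for z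
    unfolding rat_value_iff_iterated_limit
  proof (rule iterated_limit_cong)
    show "has_iterated_limit (\<lambda>x y. poly_xy P x y / poly_xy Q x y) (fst z) (snd z) (restrict h (closure G) z)"
      using val that by simp
    show "\<forall>\<^sub>F x in at (fst z). \<forall>\<^sub>F y in at (snd z).
        poly_xy P x y / poly_xy Q x y = poly_xy p x y / poly_xy q x y"
      using eventually_poly_xy_nonzero[OF d, of "snd z" "fst z"]
      by eventually_elim (auto elim!: eventually_mono simp: pq)
  qed
  moreover have "bounded (restrict h (closure G) ` G)"
  proof -
    have "restrict h (closure G) ` G = h ` G"
      using closure_subset[of G] by (intro image_cong) auto
    then show ?thesis using bdd by simp
  qed
  moreover have "continuous (at z within closure G) (restrict h (closure G))" if "z \<in> frontier G" for z
    using cont[OF that] that by (subst continuous_within_restrict) (auto simp: frontier_def)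
  moreover have "q \<noteq> 0" using Q pq by auto
  ultimately show ?thesis
    unfolding rat_fun_def using pq(3)
    by (intro CollectI conjI exI[of _ p] exI[of _ q] ballI) auto
qed

lemma rat_fun_add:
  assumes "f \<in> rat_fun G" "g \<in> rat_fun G"
  shows "(\<lambda>z\<in>closure G. f z + g z) \<in> rat_fun G"
proof -
  obtain p q where f: "q \<noteq> 0" "\<And>z. z \<in> closure G \<Longrightarrow> rat_value p q z (f z)"
    using assms(1) unfolding rat_fun_def by blast
  obtain a b where g: "b \<noteq> 0" "\<And>z. z \<in> closure G \<Longrightarrow> rat_value a b z (g z)"
    using assms(2) unfolding rat_fun_def by blast
  have qb: "q * b \<noteq> 0" using f g by simp
  show ?thesis
  proof (rule rat_funI[OF qb])
    fix z assume z: "z \<in> closure G"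
    show "has_iterated_limit (\<lambda>x y. poly_xy (p * b + a * q) x y / poly_xy (q * b) x y) (fst z) (snd z) (f z + g z)"
    proof (rule iterated_limit_cong[OF _ iterated_limit_add])
      show "\<forall>\<^sub>F x in at (fst z). \<forall>\<^sub>F y in at (snd z). poly_xy p x y / poly_xy q x y + poly_xy a x y / poly_xy b x y
          = poly_xy (p * b + a * q) x y / poly_xy (q * b) x y"
        using eventually_poly_xy_nonzero[OF qb, of "snd z" "fst z"]
        by eventually_elim (auto elim!: eventually_mono simp: add_frac_eq)
    qed (use f(2)[OF z] g(2)[OF z] in \<open>simp_all only: rat_value_iff_iterated_limit\<close>)
  next
    show "bounded ((\<lambda>z. f z + g z) ` G)"
      using assms unfolding rat_fun_def by (intro bounded_plus_comp) auto
  next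
    fix z assume "z \<in> frontier G"
    then show "continuous (at z within closure G) (\<lambda>z. f z + g z)"
      using assms unfolding rat_fun_def by (intro continuous_add) auto
  qed
qed

lemma bounded_mult_image:
  fixes f g :: "'a \<Rightarrow> real"
  assumes "bounded (f ` S)" "bounded (g ` S)" shows "bounded ((\<lambda>x. f x * g x) ` S)"
proof -
  obtain C D where "\<And>x. x \<in> S \<Longrightarrow> \<bar>f x\<bar> \<le> C" "\<And>x. x \<in> S \<Longrightarrow> \<bar>g x\<bar> \<le> D"
    using assms unfolding bounded_iff by auto
  then have "\<bar>f x * g x\<bar> \<le> \<bar>C\<bar> * \<bar>D\<bar>" if "x \<in> S" for x
    unfolding abs_mult using that by (intro mult_mono) force+
  then show ?thesis unfolding bounded_iff by auto
qed

lemma rat_fun_mult: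
  assumes "f \<in> rat_fun G" "g \<in> rat_fun G"
  shows "(\<lambda>z\<in>closure G. f z * g z) \<in> rat_fun G"
proof -
  obtain p q where f: "q \<noteq> 0" "\<And>z. z \<in> closure G \<Longrightarrow> rat_value p q z (f z)"
    using assms(1) unfolding rat_fun_def by blast
  obtain a b where g: "b \<noteq> 0" "\<And>z. z \<in> closure G \<Longrightarrow> rat_value a b z (g z)"
    using assms(2) unfolding rat_fun_def by blast
  have qb: "q * b \<noteq> 0" using f g by simp
  show ?thesis
  proof (rule rat_funI[OF qb])
    fix z assume z: "z \<in> closure G"
    show "has_iterated_limit (\<lambda>x y. poly_xy (p * a) x y / poly_xy (q * b) x y) (fst z) (snd z) (f z * g z)"
      using iterated_limit_mult[OF f(2)[OF z, unfolded rat_value_iff_iterated_limit]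
          g(2)[OF z, unfolded rat_value_iff_iterated_limit]] by simp
  next
    show "bounded ((\<lambda>z. f z * g z) ` G)"
      using assms unfolding rat_fun_def by (intro bounded_mult_image) auto
  next
    fix z assume "z \<in> frontier G"
    then show "continuous (at z within closure G) (\<lambda>z. f z * g z)"
      using assms unfolding rat_fun_def by (intro continuous_mult) auto
  qed
qed

lemma rat_fun_poly_at:
  assumes "compact (closure G)"
  shows "restrict (poly_at p) (closure G) \<in> rat_fun G"
proof (rule rat_funI[where P = p and Q = 1])
  show "has_iterated_limit (\<lambda>x y. poly_xy p x y / poly_xy 1 x y) (fst z) (snd z) (poly_at p z)" for z
    unfolding rat_value_iff_iterated_limit[symmetric] by (simp add: rat_value_def poly_at_def)
  have "bounded (poly_at p ` closure G)"
    by (intro compact_imp_bounded compact_continuous_image continuous_on_poly_at assms)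
  then show "bounded (poly_at p ` G)" using closure_subset bounded_subset image_mono by metis
qed (simp_all add: continuous_at_imp_continuous_at_within isCont_poly_at)

lemma bfun_iff: "f \<in> bfun G \<longleftrightarrow> f \<in> extensional (closure G) \<and> bounded (f ` closure G)"
  by (auto simp: bfun_metric_def Met_TC.fspace_def)

text \<open>
  Boundedness on \<open>G\<close> extends to the boundary by continuity there.
\<close>

lemma rat_fun_subset_bfun:
  assumes "open G" "f \<in> rat_fun G" shows "f \<in> bfun G"
proof -
  obtain C where C: "\<And>z. z \<in> G \<Longrightarrow> \<bar>f z\<bar> \<le> C"
    using assms(2) unfolding rat_fun_def bounded_iff by auto
  have "\<bar>f z\<bar> \<le> C" if z: "z \<in> closure G" for z
  proof (cases "z \<in> G")
    case False
    then have "z \<in> frontier G" "z islimpt G"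
      using z assms(1) by (auto simp: frontier_def interior_open closure_def)
    then have "(f \<longlongrightarrow> f z) (at z within closure G)"
      using assms(2) unfolding rat_fun_def continuous_within by blast
    then have "((\<lambda>w. \<bar>f w\<bar>) \<longlongrightarrow> \<bar>f z\<bar>) (at z within G)"
      by (intro tendsto_rabs) (rule tendsto_within_subset[OF _ closure_subset])
    moreover have "\<forall>\<^sub>F w in at z within G. \<bar>f w\<bar> \<le> C"
      using C by (simp add: eventually_at_filter)
    ultimately show ?thesis
      using \<open>z islimpt G\<close> by (intro tendsto_upperbound) (auto simp: trivial_limit_within)
  qed (rule C)
  then have "bounded (f ` closure G)" unfolding bounded_iff by (intro exI[of _ C]) auto
  then show ?thesis using assms(2) by (simp add: bfun_iff rat_fun_def)
qed

lemma rat_closure_iff: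
  assumes "open G" "G \<noteq> {}"
  shows "f \<in> rat_closure G \<longleftrightarrow> f \<in> bfun G \<and>
    (\<forall>e>0. \<exists>g\<in>rat_fun G. \<forall>z\<in>closure G. \<bar>f z - g z\<bar> \<le> e)"
proof -
  have mdist: "mdist (bfun_metric G) f g \<le> e \<longleftrightarrow> (\<forall>z\<in>closure G. \<bar>f z - g z\<bar> \<le> e)"
    if "f \<in> bfun G" "g \<in> bfun G" for f g e
  proof -
    have "closure G \<noteq> {}" using assms by simp
    from funspace_mdist_le[OF that[unfolded bfun_metric_def] this]
    show ?thesis by (simp add: bfun_metric_def dist_real_def del: mdist_funspace)
  qed
  have "f \<in> rat_closure G \<longleftrightarrow> f \<in> bfun G \<and>
      (\<forall>e>0. \<exists>g\<in>rat_fun G. g \<in> bfun G \<and> mdist (bfun_metric G) f g \<le> e)"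
    unfolding rat_closure_def mtopology_of_def
    by (auto simp: Metric_space.metric_closure_of_alt Metric_space.in_mcball)
  also have "\<dots> \<longleftrightarrow> f \<in> bfun G \<and> (\<forall>e>0. \<exists>g\<in>rat_fun G. \<forall>z\<in>closure G. \<bar>f z - g z\<bar> \<le> e)"
  proof (cases "f \<in> bfun G")
    case True
    have "g \<in> bfun G \<and> mdist (bfun_metric G) f g \<le> e \<longleftrightarrow> (\<forall>z\<in>closure G. \<bar>f z - g z\<bar> \<le> e)"
      if "g \<in> rat_fun G" for g e
      using mdist[OF True] rat_fun_subset_bfun[OF assms(1) that] by blast
    then show ?thesis by (simp cong: bex_cong)
  qed simp
  finally show ?thesis .
qed

lemma rat_closure_sequence:
  assumes "open G" "G \<noteq> {}" "f \<in> rat_closure G"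
  obtains g where "\<And>n. g n \<in> rat_fun G" "uniform_limit (closure G) g f sequentially"
proof -
  have "\<forall>n. \<exists>g\<in>rat_fun G. \<forall>z\<in>closure G. \<bar>f z - g z\<bar> \<le> inverse (real (Suc n))"
    using assms rat_closure_iff[OF assms(1,2), of f] by simp
  then obtain g where g: "\<And>n. g n \<in> rat_fun G"
      "\<And>n z. z \<in> closure G \<Longrightarrow> \<bar>f z - g n z\<bar> \<le> inverse (real (Suc n))"
    by metis
  have "uniform_limit (closure G) g f sequentially"
  proof (rule uniform_limitI)
    fix e :: real assume e: "e > 0"
    have "\<forall>\<^sub>F n in sequentially. inverse (real (Suc n)) < e"
      using LIMSEQ_inverse_real_of_nat e by (rule order_tendstoD)
    then show "\<forall>\<^sub>F n in sequentially. \<forall>z\<in>closure G. dist (g n z) (f z) < e"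
    proof eventually_elim
      case (elim n)
      then show ?case using g(2)[of _ n] by (force simp: dist_real_def abs_minus_commute)
    qed
  qed
  then show thesis using that g(1) by blast
qed

lemma rat_closureI:
  assumes "open G" "G \<noteq> {}" "f \<in> bfun G" "\<And>n. g n \<in> rat_fun G"
    "uniform_limit (closure G) g f sequentially"
  shows "f \<in> rat_closure G"
proof -
  have "\<exists>h\<in>rat_fun G. \<forall>z\<in>closure G. \<bar>f z - h z\<bar> \<le> e" if e: "e > 0" for e
  proof -
    obtain n where "\<forall>z\<in>closure G. dist (g n z) (f z) < e"
      using eventually_happens[OF uniform_limitD[OF assms(5) e]] by auto
    then show ?thesis using assms(4)[of n]
      by (intro bexI[of _ "g n"]) (auto simp: dist_real_def abs_minus_commute less_imp_le)
  qed
  then show ?thesis using assms(3) by (simp add: rat_closure_iff[OF assms(1,2)])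
qed

lemma rat_closure_bfun: "f \<in> rat_closure G \<Longrightarrow> f \<in> bfun G"
  unfolding rat_closure_def by (metis closure_of_subset_topspace subsetD topspace_mtopology_of)

lemma rat_closure_add:
  assumes G: "open G" "G \<noteq> {}" and fg: "f \<in> rat_closure G" "g \<in> rat_closure G"
  shows "(\<lambda>z\<in>closure G. f z + g z) \<in> rat_closure G"
proof -
  obtain F where F: "\<And>n. F n \<in> rat_fun G" "uniform_limit (closure G) F f sequentially"
    using rat_closure_sequence[OF G fg(1)] by blast
  obtain H where H: "\<And>n. H n \<in> rat_fun G" "uniform_limit (closure G) H g sequentially"
    using rat_closure_sequence[OF G fg(2)] by blast
  have "bounded ((\<lambda>z. f z + g z) ` closure G)"
    using fg[THEN rat_closure_bfun] by (intro bounded_plus_comp) (auto simp: bfun_iff)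
  then have "(\<lambda>z\<in>closure G. f z + g z) \<in> bfun G" by (simp add: bfun_iff)
  moreover have "uniform_limit (closure G) (\<lambda>n. \<lambda>z\<in>closure G. F n z + H n z)
      (\<lambda>z\<in>closure G. f z + g z) sequentially"
    using uniform_limit_add[OF F(2) H(2)] by (simp cong: uniform_limit_cong')
  ultimately show ?thesis
    by (rule rat_closureI[OF G _ rat_fun_add[OF F(1) H(1)]])
qed

lemma rat_closure_mult:
  assumes G: "open G" "G \<noteq> {}" and fg: "f \<in> rat_closure G" "g \<in> rat_closure G"
  shows "(\<lambda>z\<in>closure G. f z * g z) \<in> rat_closure G"
proof -
  obtain F where F: "\<And>n. F n \<in> rat_fun G" "uniform_limit (closure G) F f sequentially"
    using rat_closure_sequence[OF G fg(1)] by blast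
  obtain H where H: "\<And>n. H n \<in> rat_fun G" "uniform_limit (closure G) H g sequentially"
    using rat_closure_sequence[OF G fg(2)] by blast
  have bdd: "bounded (f ` closure G)" "bounded (g ` closure G)"
    using fg[THEN rat_closure_bfun] by (auto simp: bfun_iff)
  then have "(\<lambda>z\<in>closure G. f z * g z) \<in> bfun G" by (simp add: bfun_iff bounded_mult_image)
  moreover have "uniform_limit (closure G) (\<lambda>n. \<lambda>z\<in>closure G. F n z * H n z)
      (\<lambda>z\<in>closure G. f z * g z) sequentially"
    using uniform_lim_mult[OF F(2) H(2) bdd] by (simp cong: uniform_limit_cong')
  ultimately show ?thesis
    by (rule rat_closureI[OF G _ rat_fun_mult[OF F(1) H(1)]])
qed

lemma real_polynomial_function_poly_at:
  fixes g :: "real \<times> real \<Rightarrow> real"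
  assumes "real_polynomial_function g"
  shows "\<exists>p. \<forall>z. g z = poly_at p z"
  using assms
proof (induction rule: real_polynomial_function.induct)
  case (linear g)
  have "g z = poly_at [:[:0, g (1, 0):], [:g (0, 1):]:] z" for z
  proof -
    have "z = fst z *\<^sub>R (1, 0) + snd z *\<^sub>R (0, 1)" by (cases z) simp
    then have "g z = g (fst z *\<^sub>R (1, 0) + snd z *\<^sub>R (0, 1))" by (rule arg_cong)
    also have "\<dots> = fst z * g (1, 0) + snd z * g (0, 1)"
      by (simp only: linear_simps(1)[OF linear] linear_simps(5)[OF linear] real_scaleR_def)
    finally have "g z = fst z * g (1, 0) + snd z * g (0, 1)" .
    then show ?thesis by (simp add: poly_at_def)
  qed
  then show ?case by blast
next
  case (const c)
  show ?case by (intro exI[of _ "[:[:c:]:]"]) (simp add: poly_at_def)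
next
  case (add g h)
  then obtain p q where "\<forall>z. g z = poly_at p z" "\<forall>z. h z = poly_at q z" by blast
  then show ?case by (intro exI[of _ "p + q"]) (simp add: poly_at_def)
next
  case (mult g h)
  then obtain p q where "\<forall>z. g z = poly_at p z" "\<forall>z. h z = poly_at q z" by blast
  then show ?case by (intro exI[of _ "p * q"]) (simp add: poly_at_def)
qed

lemma cfun_subset_rat_closure:
  assumes G: "open G" "G \<noteq> {}" and compact: "compact (closure G)" and f: "f \<in> cfun G"
  shows "f \<in> rat_closure G"
  unfolding rat_closure_iff[OF G]
proof (intro conjI allI impI)
  have cont: "continuous_on (closure G) f" using f by (simp add: cfun_def)
  then have "bounded (f ` closure G)"
    by (intro compact_imp_bounded compact_continuous_image compact)
  then show "f \<in> bfun G" using f by (simp add: bfun_iff cfun_def)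
  fix e :: real assume "e > 0"
  then obtain g where g: "real_polynomial_function g" "\<And>z. z \<in> closure G \<Longrightarrow> \<bar>f z - g z\<bar> < e"
    using Stone_Weierstrass_real_polynomial_function[OF compact cont] by metis
  obtain p where "\<forall>z. g z = poly_at p z" using real_polynomial_function_poly_at[OF g(1)] by blast
  then show "\<exists>h\<in>rat_fun G. \<forall>z\<in>closure G. \<bar>f z - h z\<bar> \<le> e"
    using g(2) rat_fun_poly_at[OF compact]
    by (intro bexI[of _ "restrict (poly_at p) (closure G)"]) (auto intro: less_imp_le)
qed

section \<open>Passing to uniform limits\<close>

lemma limits_dist_le:
  fixes f g :: "'a \<Rightarrow> real"
  assumes "(f \<longlongrightarrow> l) F" "(g \<longlongrightarrow> m) F" "\<forall>\<^sub>F x in F. dist (f x) (g x) \<le> e" "F \<noteq> bot"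
  shows "dist l m \<le> e"
  by (rule tendsto_upperbound[OF tendsto_dist[OF assms(1,2)] assms(3,4)])

text \<open>
  The limits of the approximating functions form a Cauchy sequence; its limit is the limit of
  the uniform limit.
\<close>

lemma uniform_limit_limit_exists:
  fixes f :: "'a \<Rightarrow> real"
  assumes U: "uniform_limit S g f sequentially" and lim: "\<And>n. (g n \<longlongrightarrow> l n) F"
    and S: "\<forall>\<^sub>F x in F. x \<in> S" and F: "F \<noteq> bot"
  shows "\<exists>L. (f \<longlongrightarrow> L) F"
proof -
  have "Cauchy l"
  proof (rule metric_CauchyI)
    fix e :: real assume "e > 0"
    then obtain M where M: "\<And>n x. n \<ge> M \<Longrightarrow> x \<in> S \<Longrightarrow> dist (g n x) (f x) < e / 4"
      using U unfolding uniform_limit_sequentially_iff by (meson zero_less_divide_iff zero_less_numeral)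
    have "dist (l m) (l n) < e" if mn: "m \<ge> M" "n \<ge> M" for m n
    proof -
      have "\<forall>\<^sub>F x in F. dist (g m x) (g n x) \<le> e / 2"
        using S
      proof eventually_elim
        case (elim x)
        have "dist (g m x) (g n x) \<le> dist (g m x) (f x) + dist (g n x) (f x)"
          by (rule dist_triangle2)
        then show ?case using M[OF mn(1) elim] M[OF mn(2) elim] by simp
      qed
      then have "dist (l m) (l n) \<le> e / 2" by (rule limits_dist_le[OF lim lim _ F])
      then show ?thesis using \<open>e > 0\<close> by simp
    qed
    then show "\<exists>M. \<forall>m\<ge>M. \<forall>n\<ge>M. dist (l m) (l n) < e" by blast
  qed
  then obtain L where L: "l \<longlonglongrightarrow> L" using Cauchy_convergent unfolding convergent_def by blast
  have "(f \<longlongrightarrow> L) F"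
    by (rule swap_uniform_limit'[OF _ L U S]) (simp_all add: lim)
  then show ?thesis by blast
qed

text \<open>
  The limits \<open>l n\<close> converge to \<open>L\<close> uniformly in the index of the filters, so convergence of
  sequences is inherited.
\<close>

lemma uniform_limit_limits_convergent:
  fixes f :: "'a \<Rightarrow> real"
  assumes U: "uniform_limit S g f sequentially"
    and lim: "\<And>n N. (g n \<longlongrightarrow> l n N) (F N)" and conv: "\<And>n. convergent (l n)"
    and L: "\<And>N. (f \<longlongrightarrow> L N) (F N)"
    and S: "\<And>N. \<forall>\<^sub>F x in F N. x \<in> S" and F: "\<And>N. F N \<noteq> bot"
  shows "convergent L"
proof -
  have "uniform_limit UNIV l L sequentially"
  proof (rule uniform_limitI)
    fix e :: real assume "e > 0"
    then have "\<forall>\<^sub>F n in sequentially. \<forall>x\<in>S. dist (g n x) (f x) < e / 2"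
      by (intro uniform_limitD[OF U]) simp
    then show "\<forall>\<^sub>F n in sequentially. \<forall>N\<in>UNIV. dist (l n N) (L N) < e"
    proof (eventually_elim, intro ballI)
      fix n N assume n: "\<forall>x\<in>S. dist (g n x) (f x) < e / 2"
      have "\<forall>\<^sub>F x in F N. dist (g n x) (f x) \<le> e / 2"
        using S by (rule eventually_mono) (use n in \<open>auto intro: less_imp_le\<close>)
      then have "dist (l n N) (L N) \<le> e / 2" by (rule limits_dist_le[OF lim L _ F])
      then show "dist (l n N) (L N) < e" using \<open>e > 0\<close> by simp
    qed
  qed
  moreover have "\<exists>k. l n \<longlonglongrightarrow> k" for n using conv[of n] unfolding convergent_def .
  then obtain k where "\<And>n. l n \<longlonglongrightarrow> k n" by metis
  ultimately have "\<exists>M. L \<longlonglongrightarrow> M"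
    by (intro uniform_limit_limit_exists[where S = UNIV and g = l and l = k]) auto
  then show ?thesis unfolding convergent_def .
qed

lemma uniform_limit_continuous_within:
  fixes f :: "'a :: t2_space \<Rightarrow> real"
  assumes U: "uniform_limit S g f sequentially" and z: "z \<in> S"
    and cont: "\<And>n. continuous (at z within S) (g n)"
  shows "continuous (at z within S) f"
  unfolding continuous_within
proof (rule swap_uniform_limit[OF _ _ U])
  show "(\<lambda>n. g n z) \<longlonglongrightarrow> f z" using U z by (rule tendsto_uniform_limitI)
  show "\<forall>\<^sub>F n in sequentially. (g n \<longlongrightarrow> g n z) (at z within S)"
    using cont unfolding continuous_within by simp
qed simp

lemma rat_closure_countable_discontinuities:
  assumes G: "open G" "G \<noteq> {}" and f: "f \<in> rat_closure G"
  shows "countable {z \<in> closure G. \<not> continuous (at z within closure G) f}"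
proof -
  obtain g where g: "\<And>n. g n \<in> rat_fun G" "uniform_limit (closure G) g f sequentially"
    using rat_closure_sequence[OF G f] by blast
  have "{z \<in> closure G. \<not> continuous (at z within closure G) f}
      \<subseteq> (\<Union>n. {z \<in> closure G. \<not> continuous (at z within closure G) (g n)})"
    using uniform_limit_continuous_within[OF g(2)] by blast
  moreover have "countable (\<Union>n. {z \<in> closure G. \<not> continuous (at z within closure G) (g n)})"
    using rat_fun_finitely_many_discontinuities[OF G(1) g(1)]
    by (intro countable_UN) (auto intro: countable_finite)
  ultimately show ?thesis by (rule countable_subset)
qed

lemma rat_closure_limit_along_curve:
  assumes G: "open G" "G \<noteq> {}" and f: "f \<in> rat_closure G" and z: "z \<in> G"
    and h: "h \<in> log_sums UNIV" "(h \<longlongrightarrow> 0) (at_right 0)"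
  shows "\<exists>l. ((\<lambda>t. f (side_point s z t (h t))) \<longlongrightarrow> l) (at_right 0)"
proof -
  obtain g where g: "\<And>n. g n \<in> rat_fun G" "uniform_limit (closure G) g f sequentially"
    using rat_closure_sequence[OF G f] by blast
  let ?F = "filtermap (\<lambda>t. side_point s z t (h t)) (at_right 0)"
  have "\<exists>l. (g n \<longlongrightarrow> l) ?F" for n
    using rat_fun_limit_along_curve[OF G(1) g(1) z h] by (simp add: filterlim_filtermap)
  then obtain l where l: "\<And>n. (g n \<longlongrightarrow> l n) ?F" by metis
  have "\<forall>\<^sub>F t in at_right 0. side_point s z t (h t) \<in> G"
    using side_point_tendsto[OF h(2)] G(1) z by (rule topological_tendstoD)
  then have "\<forall>\<^sub>F w in ?F. w \<in> closure G"
    unfolding eventually_filtermap by (rule eventually_mono) (use closure_subset in blast)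
  moreover have "?F \<noteq> bot" by (simp add: filtermap_bot_iff)
  ultimately have "\<exists>L. (f \<longlongrightarrow> L) ?F" by (rule uniform_limit_limit_exists[OF g(2) l])
  then show ?thesis by (simp add: filterlim_filtermap)
qed

lemma rat_closure_limits_along_series_converge:
  assumes G: "open G" "G \<noteq> {}" and f: "f \<in> rat_closure G" and z: "z \<in> G" and II: "type_II \<phi> e"
    and lim: "\<And>N. ((\<lambda>t. f (side_point s z t (Phi N \<phi> e t))) \<longlongrightarrow> L N) (at_right 0)"
  shows "convergent L"
proof -
  obtain g where g: "\<And>n. g n \<in> rat_fun G" "uniform_limit (closure G) g f sequentially"
    using rat_closure_sequence[OF G f] by blast
  let ?F = "\<lambda>N. filtermap (\<lambda>t. side_point s z t (Phi N \<phi> e t)) (at_right 0)"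
  have Phi: "Phi N \<phi> e \<in> log_sums UNIV" "(Phi N \<phi> e \<longlongrightarrow> 0) (at_right 0)" for N
    using II unfolding type_II_def by (auto intro: Phi_tendsto_0 log_sums_Phi)
  have "\<exists>l. ((\<lambda>t. g n (side_point s z t (Phi N \<phi> e t))) \<longlongrightarrow> l) (at_right 0)" for n N
    by (rule rat_fun_limit_along_curve[OF G(1) g(1) z Phi])
  then obtain l where l: "\<And>n N. ((\<lambda>t. g n (side_point s z t (Phi N \<phi> e t))) \<longlongrightarrow> l n N) (at_right 0)"
    by metis
  show ?thesis
  proof (rule uniform_limit_limits_convergent[OF g(2)])
    show "(g n \<longlongrightarrow> l n N) (?F N)" for n N using l by (simp add: filterlim_filtermap)
    show "(f \<longlongrightarrow> L N) (?F N)" for N using lim by (simp add: filterlim_filtermap)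
    show "convergent (l n)" for n
      by (rule rat_fun_limits_along_series_converge[OF G(1) g(1) z II l])
    have "\<forall>\<^sub>F t in at_right 0. side_point s z t (Phi N \<phi> e t) \<in> G" for N
      using side_point_tendsto[OF Phi(2)] G(1) z by (rule topological_tendstoD)
    then show "\<forall>\<^sub>F w in ?F N. w \<in> closure G" for N
      unfolding eventually_filtermap by (rule eventually_mono) (use closure_subset in blast)
    show "?F N \<noteq> bot" for N by (simp add: filtermap_bot_iff)
  qed
qed

text \<open>
  Each defining condition of the space is a statement about limits that holds for rational
  functions and survives uniform limits.
\<close>

lemma rat_closure_subset_L_space:
  assumes G: "open G" "G \<noteq> {}" and f: "f \<in> rat_closure G"
  shows "f \<in> L_space G"
proof -
  have bfun: "f \<in> bfun G" using f by (rule rat_closure_bfun)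
  have frontier: "continuous (at z within closure G) f" if "z \<in> frontier G" for z
  proof -
    obtain g where g: "\<And>n. g n \<in> rat_fun G" "uniform_limit (closure G) g f sequentially"
      using rat_closure_sequence[OF G f] by blast
    show ?thesis
      by (rule uniform_limit_continuous_within[OF g(2)])
        (use that g(1) in \<open>auto simp: rat_fun_def frontier_def\<close>)
  qed
  have curves: "\<exists>l. (f \<longlongrightarrow> l) (at z within half_curve s h z)" if zh: "z \<in> G" "test_fun h" for z s h
  proof -
    obtain l where "((\<lambda>t. f (side_point s z t (h t))) \<longlongrightarrow> l) (at_right 0)"
      using rat_closure_limit_along_curve[OF G f zh(1)] zh(2)
        test_fun_log_sums test_fun_tendsto_0 by blast
    then have "(f \<longlongrightarrow> l) (at z within half_curve s h z)"
      by (intro tendsto_half_curve test_fun_even test_fun_0 zh)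
    then show ?thesis by blast
  qed
  have series: "\<exists>l. (\<forall>N. (f \<longlongrightarrow> l N) (at z within half_curve s (Phi N \<phi> e) z)) \<and> convergent l"
    if "z \<in> G" "type_II \<phi> e" for z s \<phi> e
  proof -
    have test: "test_fun (Phi N \<phi> e)" for N
      using that(2) unfolding type_II_def by (intro test_fun.plain) blast
    have "\<exists>l. ((\<lambda>t. f (side_point s z t (Phi N \<phi> e t))) \<longlongrightarrow> l) (at_right 0)" for N
      by (intro rat_closure_limit_along_curve[OF G f that(1)] test_fun_log_sums test_fun_tendsto_0 test)
    then obtain l where l: "\<And>N. ((\<lambda>t. f (side_point s z t (Phi N \<phi> e t))) \<longlongrightarrow> l N) (at_right 0)"
      by metis
    have "(f \<longlongrightarrow> l N) (at z within half_curve s (Phi N \<phi> e) z)" for N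
      by (intro tendsto_half_curve test_fun_even test_fun_0 test l)
    moreover have "convergent l"
      by (rule rat_closure_limits_along_series_converge[OF G f that l])
    ultimately show ?thesis by blast
  qed
  show ?thesis
    unfolding L_space_def using bfun frontier curves series by blast
qed

section \<open>Characters from cluster values\<close>

lemma compact_pointwise_bounded:
  fixes B :: "'i \<Rightarrow> real"
  shows "compact (Pi\<^sub>E UNIV (\<lambda>i. {- B i..B i}))"
proof -
  have "compactin (product_topology (\<lambda>i. euclidean) UNIV) (Pi\<^sub>E UNIV (\<lambda>i. {- B i..B i}))"
    unfolding compactin_PiE by simp
  then show ?thesis by (simp add: euclidean_product_topology)
qed

text \<open>
  A cluster value is a limit along a proper filter of points that converge to \<open>z\<close>.
\<close>

lemma cluster_filter:
  assumes d: "d \<in> cluster_values G f z"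
  shows "inf (nhds z) (inf (principal (closure G)) (filtercomap f (nhds d))) \<noteq> bot"
proof
  assume "inf (nhds z) (inf (principal (closure G)) (filtercomap f (nhds d))) = bot"
  then have "eventually (\<lambda>_. False) (inf (nhds z) (inf (principal (closure G)) (filtercomap f (nhds d))))"
    by simp
  then obtain P Q where P: "eventually P (nhds z)"
      and Q: "eventually Q (inf (principal (closure G)) (filtercomap f (nhds d)))"
      and PQ: "\<And>w. P w \<Longrightarrow> Q w \<Longrightarrow> False"
    unfolding eventually_inf[of _ "nhds z"] by auto
  obtain U where U: "open U" "z \<in> U" "\<And>w. w \<in> U \<Longrightarrow> P w"
    using P unfolding eventually_nhds by blast
  obtain R where R: "eventually R (nhds d)" "\<And>w. w \<in> closure G \<Longrightarrow> R (f w) \<Longrightarrow> Q w"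
    using Q unfolding inf.commute[of "principal _"] eventually_inf_principal eventually_filtercomap by blast
  obtain W where W: "open W" "d \<in> W" "\<And>x. x \<in> W \<Longrightarrow> R x"
    using R(1) unfolding eventually_nhds by blast
  have "d \<in> closure (f ` (U \<inter> closure G))"
    using d U(1,2) unfolding cluster_values_def by blast
  then have "W \<inter> f ` (U \<inter> closure G) \<noteq> {}"
    using W(1,2) unfolding closure_iff_nhds_not_empty by blast
  then show False using U(3) R(2) W(3) PQ by blast
qed

text \<open>
  Evaluations at points are multiplicative and linear. A cluster point of them in the topology
  of pointwise convergence, along a filter of points that tends to \<open>z\<close> and along which \<open>f\<close> tends to
  \<open>d\<close>, inherits all algebraic identities. On functions with a limit along the filter it takes this
  limit, that is \<open>d\<close> on \<open>f\<close> and the value at \<open>z\<close> on continuous functions. Such a cluster point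
  exists by Tychonoff's theorem, since elements of the algebra are bounded.
\<close>

lemma exists_character_with_cluster_value:
  assumes G: "open G" "G \<noteq> {}" and compact: "compact (closure G)"
    and f: "f \<in> rat_closure G" and z: "z \<in> G" and d: "d \<in> cluster_values G f z"
  shows "\<exists>\<psi>\<in>characters_at G z. \<psi> f = d"
proof -
  \<comment> \<open>Points of the closure that tend to \<open>z\<close> while \<open>f\<close> tends to \<open>d\<close>.\<close>
  define F where "F = inf (nhds z) (inf (principal (closure G)) (filtercomap f (nhds d)))"
  have F: "F \<noteq> bot" unfolding F_def by (rule cluster_filter[OF d])
  have inG: "\<forall>\<^sub>F w in F. w \<in> closure G"
    unfolding le_principal[symmetric] F_def by (simp add: le_infI1 le_infI2)
  have fd: "(f \<longlongrightarrow> d) F"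
    unfolding F_def filterlim_iff_le_filtercomap by (simp add: le_infI2)
  \<comment> \<open>The value \<open>0\<close> off the algebra confines all evaluations to a product of compact intervals.\<close>
  define ev where "ev w g = (if g \<in> rat_closure G then g w else 0)"
    for w :: "real \<times> real" and g :: "real \<times> real \<Rightarrow> real"
  have "\<forall>g. \<exists>b. \<forall>w\<in>closure G. \<bar>ev w g\<bar> \<le> b"
  proof
    fix g
    show "\<exists>b. \<forall>w\<in>closure G. \<bar>ev w g\<bar> \<le> b"
    proof (cases "g \<in> rat_closure G")
      case True
      then have "bounded (g ` closure G)" using rat_closure_bfun bfun_iff by blast
      then show ?thesis using True by (auto simp: bounded_iff ev_def)
    qed (auto simp: ev_def)
  qed
  then obtain B where B: "\<And>g w. w \<in> closure G \<Longrightarrow> \<bar>ev w g\<bar> \<le> B g" by metis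
  have "\<forall>\<^sub>F \<theta> in filtermap ev F. \<theta> \<in> Pi\<^sub>E UNIV (\<lambda>g. {- B g..B g})"
    unfolding eventually_filtermap using inG
    by (rule eventually_mono) (use B in \<open>auto simp: abs_le_iff minus_le_iff\<close>)
  moreover have "filtermap ev F \<noteq> bot" using F by (simp add: filtermap_bot_iff)
  ultimately obtain \<psi> where \<psi>: "inf (nhds \<psi>) (filtermap ev F) \<noteq> bot"
    using compact_pointwise_bounded[of B] unfolding compact_filter by blast
  define H where "H = inf (nhds \<psi>) (filtermap ev F)"
  have H: "H \<noteq> bot" "H \<le> nhds \<psi>" "H \<le> filtermap ev F" using \<psi> by (simp_all add: H_def)
  have coord: "((\<lambda>\<theta>. \<theta> g) \<longlongrightarrow> \<psi> g) H" for g
  proof -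
    have "((\<lambda>\<theta>. \<theta> g) \<longlongrightarrow> \<psi> g) (nhds \<psi>)"
    proof (rule topological_tendstoI)
      fix S :: "real set" assume "open S" "\<psi> g \<in> S"
      moreover have "open ((\<lambda>\<theta>. \<theta> g) -` S)"
        by (rule open_vimage[OF \<open>open S\<close> continuous_on_product_coordinates])
      ultimately show "\<forall>\<^sub>F \<theta> in nhds \<psi>. \<theta> g \<in> S"
        unfolding eventually_nhds by (intro exI[of _ "(\<lambda>\<theta>. \<theta> g) -` S"]) auto
    qed
    then show ?thesis using H(2) by (rule tendsto_mono[rotated])
  qed
  have relation: "\<forall>\<^sub>F \<theta> in H. P \<theta>" if "\<And>w. w \<in> closure G \<Longrightarrow> P (ev w)" for P
  proof -
    have "\<forall>\<^sub>F \<theta> in filtermap ev F. P \<theta>"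
      unfolding eventually_filtermap using inG by (rule eventually_mono) (rule that)
    then show ?thesis using H(3) by (rule filter_leD[rotated])
  qed
  have transfer: "\<psi> g = k" if "g \<in> rat_closure G" "(g \<longlongrightarrow> k) F" for g k
  proof -
    have "((\<lambda>\<theta>. \<theta> g) \<longlongrightarrow> k) (filtermap ev F)"
      using that by (simp add: filterlim_filtermap ev_def)
    then have "((\<lambda>\<theta>. \<theta> g) \<longlongrightarrow> k) H" using H(3) by (rule tendsto_mono[rotated])
    then show ?thesis using coord tendsto_unique[OF H(1)] by blast
  qed
  have cont: "\<psi> g = g z" if g: "g \<in> cfun G" for g
  proof (rule transfer)
    show "g \<in> rat_closure G" by (rule cfun_subset_rat_closure[OF G compact g])
    have "z \<in> closure G" using z closure_subset by blast
    then have "(g \<longlongrightarrow> g z) (inf (nhds z) (principal (closure G)))"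
      using g unfolding cfun_def continuous_on_def tendsto_at_within_iff_tendsto_nhds
      by blast
    then show "(g \<longlongrightarrow> g z) F"
      by (rule tendsto_mono[rotated]) (simp add: F_def le_infI2 inf.coboundedI1)
  qed
  have const: "(\<lambda>w\<in>closure G. c) \<in> cfun G" for c
  proof -
    have "continuous_on (closure G) (\<lambda>w\<in>closure G. c)"
      by (rule continuous_on_eq[OF continuous_on_const[of _ c]]) simp
    then show ?thesis by (simp add: cfun_def)
  qed
  have add: "\<psi> (\<lambda>w\<in>closure G. g w + h w) = \<psi> g + \<psi> h"
    if gh: "g \<in> rat_closure G" "h \<in> rat_closure G" for g h
  proof -
    have "\<forall>\<^sub>F \<theta> in H. \<theta> g + \<theta> h = \<theta> (\<lambda>w\<in>closure G. g w + h w)"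
      by (rule relation) (use gh rat_closure_add[OF G gh] in \<open>simp add: ev_def\<close>)
    with tendsto_add[OF coord[of g] coord[of h]]
    have "((\<lambda>\<theta>. \<theta> (\<lambda>w\<in>closure G. g w + h w)) \<longlongrightarrow> \<psi> g + \<psi> h) H"
      by (rule Lim_transform_eventually)
    then show ?thesis using coord tendsto_unique[OF H(1)] by blast
  qed
  have mult: "\<psi> (\<lambda>w\<in>closure G. g w * h w) = \<psi> g * \<psi> h"
    if gh: "g \<in> rat_closure G" "h \<in> rat_closure G" for g h
  proof -
    have "\<forall>\<^sub>F \<theta> in H. \<theta> g * \<theta> h = \<theta> (\<lambda>w\<in>closure G. g w * h w)"
      by (rule relation) (use gh rat_closure_mult[OF G gh] in \<open>simp add: ev_def\<close>)
    with tendsto_mult[OF coord[of g] coord[of h]]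
    have "((\<lambda>\<theta>. \<theta> (\<lambda>w\<in>closure G. g w * h w)) \<longlongrightarrow> \<psi> g * \<psi> h) H"
      by (rule Lim_transform_eventually)
    then show ?thesis using coord tendsto_unique[OF H(1)] by blast
  qed
  have const_closure: "(\<lambda>w\<in>closure G. c) \<in> rat_closure G" for c
    by (rule cfun_subset_rat_closure[OF G compact const])
  have zG: "z \<in> closure G" using z closure_subset by blast
  have scale_eq: "(\<lambda>w\<in>closure G. (\<lambda>w\<in>closure G. c) w * g w) = (\<lambda>w\<in>closure G. c * g w)" for c g
    by (auto simp: restrict_def)
  have scale: "\<psi> (\<lambda>w\<in>closure G. c * g w) = c * \<psi> g" "(\<lambda>w\<in>closure G. c * g w) \<in> rat_closure G"
    if g: "g \<in> rat_closure G" for c g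
    using mult[OF const_closure[of c] g] rat_closure_mult[OF G const_closure[of c] g] cont[OF const[of c]] zG
    unfolding scale_eq by simp_all
  have one: "\<psi> (\<lambda>w\<in>closure G. 1) \<noteq> 0" using cont[OF const[of 1]] zG by simp
  have "restrict \<psi> (rat_closure G) \<in> characters G"
    unfolding characters_def
    using add mult scale rat_closure_add[OF G] rat_closure_mult[OF G] one const_closure[of 1]
    by (auto intro!: bexI[of _ "\<lambda>w\<in>closure G. 1"])
  moreover have "restrict \<psi> (rat_closure G) g = g z" if "g \<in> cfun G" for g
    using cont[OF that] cfun_subset_rat_closure[OF G compact that] by simp
  ultimately have "restrict \<psi> (rat_closure G) \<in> characters_at G z"
    unfolding characters_at_def by blast
  moreover have "restrict \<psi> (rat_closure G) f = d" using transfer[OF f fd] f by simp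
  ultimately show ?thesis by blast
qed

theorem corollary5:
  fixes G :: "(real \<times> real) set" and f :: "real \<times> real \<Rightarrow> real"
  assumes "open G" and "connected G" and "G \<noteq> {}" and "compact (closure G)"
    and "f \<in> rat_closure G"
  shows "countable {z \<in> closure G. \<not> continuous (at z within closure G) f} \<and>
    f \<in> L_space G \<and>
    (\<forall>z\<in>G. \<forall>d\<in>cluster_values G f z. \<exists>\<psi>\<in>characters_at G z. \<psi> f = d)"
  using assms rat_closure_countable_discontinuities rat_closure_subset_L_space
    exists_character_with_cluster_value
  by (intro conjI ballI) auto

end
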